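(* Let $R\subseteq\mathbb{Z}$ be a finite set and $K\in\mathbb{N}$. There exists $C=C(K,R)\in\mathbb{N}$ such that the following holds. If $n\in\mathbb{N}$ and $$f(\theta)=\sum_{r=1}^nA_r\cos(r\theta)+\sum_{r=1}^nB_r\sin(r\theta)$$ is a trigonometric polynomial with at most $K$ roots in $[0,2\pi]$ and with $A_r,B_r\in R$ for all $r$, then there exist an integer $L<C$ and disjoint intervals of integers $I_1,\dots,I_L$ with $\bigcup_{i=1}^LI_i=\{1,\dots,n\}$ such that, for all $i\in\{1,\dots,L\}$, the sequences $(A_r)_{r\in I_i}$ and $(B_r)_{r\in I_i}$ are periodic with period at most $C$.
   Context: $\mathbb{N}=\{1,2,3,\dots\}$. A sequence $(x_r)_{r\in I}$ indexed by an interval of integers $I$ is periodic with period $p\in\mathbb{N}$ if $x_r=x_{r+p}$ whenever $r,r+p\in I$. *)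

theory Defs
  imports "HOL-Analysis.Analysis" "HOL-Library.Disjoint_Sets"
begin

definition int_interval :: "int set \<Rightarrow> bool" where
  "int_interval I \<longleftrightarrow> (\<forall>x\<in>I. \<forall>y\<in>I. {x..y} \<subseteq> I)"

definition periodic_on :: "int set \<Rightarrow> (int \<Rightarrow> 'a) \<Rightarrow> nat \<Rightarrow> bool" where
  "periodic_on I x p \<longleftrightarrow> p \<ge> 1 \<and> (\<forall>r. r \<in> I \<and> r + int p \<in> I \<longrightarrow> x r = x (r + int p))"

definition trig_poly :: "(int \<Rightarrow> int) \<Rightarrow> (int \<Rightarrow> int) \<Rightarrow> nat \<Rightarrow> real \<Rightarrow> real" where
  "trig_poly A B n \<theta> =
     (\<Sum>r = 1..int n. real_of_int (A r) * cos (real_of_int r * \<theta>))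
   + (\<Sum>r = 1..int n. real_of_int (B r) * sin (real_of_int r * \<theta>))"

(* Roots are counted without multiplicity. Finiteness is explicit because card of an
   infinite set is 0; it excludes the zero polynomial. *)
definition at_most_roots :: "nat \<Rightarrow> (real \<Rightarrow> real) \<Rightarrow> real set \<Rightarrow> bool" where
  "at_most_roots K f S \<longleftrightarrow> finite {\<theta> \<in> S. f \<theta> = 0} \<and> card {\<theta> \<in> S. f \<theta> = 0} \<le> K"

end

theory Submission
  imports Defs
begin

text \<open>
  Write \<open>2 f = \<Sum> c\<^sub>r e\<^sup>i\<^sup>r\<^sup>\<theta>\<close>, where the \<open>c\<^sub>r\<close> are Gaussian integers from a finite set. Multiplying \<open>f\<close> by
  \<open>2K\<close> factors \<open>sin ((\<theta> - t) / 2)\<close>, one for each sign change and the others with \<open>t = 0\<close>, makes it of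
  constant sign. Hence \<open>h = 2 f P(e\<^sup>i\<^sup>\<theta>)\<close>, with \<open>P = \<Prod> (z - e\<^sup>i\<^sup>t)\<close>, has the \<open>L\<^sup>1\<close> norm of a single Fourier
  coefficient, which is bounded. The Fourier coefficients of \<open>h\<close> are the values of a linear recurrence
  operator with unimodular end coefficients on the windows of \<open>c\<close>: where such a coefficient is small,
  \<open>c\<^sub>r\<close> is determined by its \<open>2K\<close> predecessors, and so \<open>c\<close> is eventually periodic there. It remains to
  bound the number of large coefficients.

  That bound is a qualitative form of Littlewood's \<open>L\<^sup>1\<close> conjecture in the style of Cohen and Davenport: if every
  Fourier coefficient of \<open>h\<close> is either at least \<open>c\<close> or at most a tiny \<open>\<epsilon>\<close>, then boundedly many
  are large. Otherwise, average the phase-adjusted exponentials of large frequencies over successive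
  blocks; by the parallelogram identity some blocks have averages \<open>u\<^sub>0, u\<^sub>1, \<dots>\<close> that almost coincide in
  \<open>L\<^sup>2(|h|)\<close>. Test \<open>h\<close> against \<open>T = u\<^sub>0 \<Prod>\<^sub>l (1 - u\<^sub>2\<^sub>l\<^sub>+\<^sub>1 cnj u\<^sub>2\<^sub>l\<^sub>+\<^sub>2)\<close>. If the frequencies are chosen greedily, all
  new frequencies in \<open>T\<close> carry small coefficients, so \<open>\<integral> h T \<approx> \<integral> h u\<^sub>0 \<ge> c\<close>; but
  \<open>|T| \<approx> |u\<^sub>0| (1 - |u\<^sub>0|\<^sup>2)\<^sup>k\<close> is uniformly small.

  The coefficients of \<open>h\<close> take boundedly many values, so among sufficiently many scales there is one at
  which this dichotomy holds.
\<close>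

subsection \<open>Exponential sums\<close>

lemma integral_cis:
  "integral {0..2*pi} (\<lambda>\<theta>. cis (of_int m * \<theta>)) = (if m = 0 then 2 * of_real pi else 0)"
proof (cases "m = 0")
  case False
  let ?F = "\<lambda>x::real. cis (of_int m * x) / (\<i> * of_int m)"
  have "((\<lambda>\<theta>. cis (of_int m * \<theta>)) has_integral (?F (2*pi) - ?F 0)) {0..2*pi}"
  proof (rule fundamental_theorem_of_calculus)
    fix x :: real
    have "((\<lambda>z. exp (\<i> * of_int m * z) / (\<i> * of_int m)) has_field_derivative
            exp (\<i> * of_int m * of_real x)) (at (of_real x))"
      using False by (auto intro!: derivative_eq_intros)
    then have "((\<lambda>x. exp (\<i> * of_int m * of_real x) / (\<i> * of_int m)) has_vector_derivative
            exp (\<i> * of_int m * of_real x)) (at x within {0..2*pi})"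
      by (rule has_vector_derivative_real_field)
    then show "(?F has_vector_derivative cis (of_int m * x)) (at x within {0..2*pi})"
      by (simp add: cis_conv_exp mult.assoc)
  qed simp
  moreover have "cis (of_int m * (2*pi)) = 1"
    using cis_multiple_2pi[of "of_int m"] by (simp add: mult_ac)
  ultimately show ?thesis
    using False by (simp add: integral_unique)
qed (simp add: scaleR_conv_of_real)

text \<open>\<open>M\<close> bounds the sum of the moduli of the coefficients in some representation
  with frequencies in \<open>F\<close>, so that it multiplies under products. The sign in the
  exponent makes the integral of \<open>h\<close> against the exponential of frequency
  \<open>s\<close> equal to \<open>fourier_coeff h s\<close>.\<close>

inductive expsum :: "int set \<Rightarrow> real \<Rightarrow> (real \<Rightarrow> complex) \<Rightarrow> bool" for F where
  single: "s \<in> F \<Longrightarrow> norm a \<le> M \<Longrightarrow> expsum F M (\<lambda>\<theta>. a * cis (- (of_int s * \<theta>)))"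
| add: "expsum F M u \<Longrightarrow> expsum F M' v \<Longrightarrow> expsum F (M + M') (\<lambda>\<theta>. u \<theta> + v \<theta>)"

lemma expsum_mono: "expsum F M u \<Longrightarrow> F \<subseteq> G \<Longrightarrow> expsum G M u"
  by (induction rule: expsum.induct) (auto intro: expsum.intros)

lemma expsum_scale: "expsum F M u \<Longrightarrow> expsum F (norm c * M) (\<lambda>\<theta>. c * u \<theta>)"
proof (induction rule: expsum.induct)
  case (single s a M)
  then have "expsum F (norm c * M) (\<lambda>\<theta>. (c * a) * cis (- (of_int s * \<theta>)))"
    by (intro expsum.single) (auto simp: norm_mult intro: mult_left_mono)
  then show ?case by (simp add: mult.assoc)
next
  case (add M u M' v)
  from expsum.add[OF add.IH] show ?case by (simp add: distrib_left)
qed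

lemma expsum_cnj: "expsum F M u \<Longrightarrow> expsum (uminus ` F) M (\<lambda>\<theta>. cnj (u \<theta>))"
proof (induction rule: expsum.induct)
  case (single s a M)
  then have "expsum (uminus ` F) M (\<lambda>\<theta>. cnj a * cis (- (of_int (- s) * \<theta>)))"
    by (intro expsum.single) auto
  then show ?case by (simp add: cis_cnj)
next
  case (add M u M' v)
  from expsum.add[OF add.IH] show ?case by simp
qed

lemma expsum_mult:
  "expsum F M u \<Longrightarrow> expsum G M' v \<Longrightarrow>
    expsum {f + g |f g. f \<in> F \<and> g \<in> G} (M * M') (\<lambda>\<theta>. u \<theta> * v \<theta>)"
proof (induction arbitrary: M' v rule: expsum.induct)
  case (single s a M)
  have "0 \<le> M" using single.hyps by (meson norm_ge_zero order_trans)
  from single.prems show ?case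
  proof (induction rule: expsum.induct)
    case (single t b M')
    have "norm (a * b) \<le> M * M'"
      using single \<open>norm a \<le> M\<close> \<open>0 \<le> M\<close> by (simp add: norm_mult mult_mono)
    then have "expsum {f + g |f g. f \<in> F \<and> g \<in> G} (M * M')
        (\<lambda>\<theta>. (a * b) * cis (- (of_int (s + t) * \<theta>)))"
      using single \<open>s \<in> F\<close> by (intro expsum.single) auto
    moreover have "(a * b) * cis (- (of_int (s + t) * \<theta>))
        = a * cis (- (of_int s * \<theta>)) * (b * cis (- (of_int t * \<theta>)))" for \<theta>
      by (simp add: cis_mult distrib_right)
    ultimately show ?case by (simp only:)
  next
    case (add M1 v1 M2 v2)
    from expsum.add[OF add.IH] show ?case by (simp add: distrib_left)
  qed
next
  case (add M1 u1 M2 u2)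
  from expsum.add[OF add.IH(1)[OF add.prems] add.IH(2)[OF add.prems]]
  show ?case by (simp add: distrib_right)
qed

lemma expsum_continuous: "expsum F M u \<Longrightarrow> continuous_on S u"
  by (induction rule: expsum.induct) (auto intro!: continuous_intros)

lemma expsum_norm_le: "expsum F M u \<Longrightarrow> norm (u \<theta>) \<le> M"
proof (induction rule: expsum.induct)
  case (add M u M' v)
  then show ?case by (meson norm_triangle_mono)
qed (simp add: norm_mult)

text \<open>Not normalised: the factor \<open>2 * pi\<close> reappears in the constants
  below.\<close>

definition fourier_coeff :: "(real \<Rightarrow> complex) \<Rightarrow> int \<Rightarrow> complex" where
  "fourier_coeff h r = integral {0..2*pi} (\<lambda>\<theta>. h \<theta> * cis (- (of_int r * \<theta>)))"

text \<open>By linearity each exponential of \<open>u\<close> picks out one coefficient of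
  \<open>h\<close>, weighted by its own coefficient. It serves for test functions whose frequencies
  avoid the large coefficients of \<open>h\<close>.\<close>

lemma expsum_pairing:
  assumes "expsum F M u" "continuous_on {0..2*pi} h" "\<And>s. s \<in> F \<Longrightarrow> norm (fourier_coeff h s) \<le> e"
  shows "norm (integral {0..2*pi} (\<lambda>\<theta>. h \<theta> * u \<theta>)) \<le> e * M"
  using assms(1)
proof (induction rule: expsum.induct)
  case (single s a M)
  have "integral {0..2*pi} (\<lambda>\<theta>. h \<theta> * (a * cis (- (of_int s * \<theta>)))) = a * fourier_coeff h s"
    unfolding fourier_coeff_def by (subst integral_mult_right[symmetric]) (simp add: mult_ac)
  moreover have "norm (a * fourier_coeff h s) \<le> e * M"
    using mult_mono[OF single(2) assms(3)[OF single(1)]] single(2)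
    by (metis norm_ge_zero norm_mult mult.commute order_trans)
  ultimately show ?case by simp
next
  case (add M u M' v)
  have i: "(\<lambda>\<theta>. h \<theta> * u \<theta>) integrable_on {0..2*pi}" "(\<lambda>\<theta>. h \<theta> * v \<theta>) integrable_on {0..2*pi}"
    by (intro integrable_continuous_interval continuous_intros assms(2)
        expsum_continuous[OF add.hyps(1)] expsum_continuous[OF add.hyps(2)])+
  then have "integral {0..2*pi} (\<lambda>\<theta>. h \<theta> * (u \<theta> + v \<theta>))
     = integral {0..2*pi} (\<lambda>\<theta>. h \<theta> * u \<theta>) + integral {0..2*pi} (\<lambda>\<theta>. h \<theta> * v \<theta>)"
    by (simp add: distrib_left integral_add)
  with add.IH show ?case by (simp add: distrib_left norm_triangle_mono)
qed

subsection \<open>Energy decrement\<close>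

text \<open>If each of the successive groups of \<open>p\<close> points contains two points that are far apart, their
  midpoints form a sequence of the same kind with \<open>q\<close> decreased by \<open>\<delta>\<close>, which can happen only \<open>t\<close> times.\<close>

lemma energy_decrement:
  fixes q :: "'i \<Rightarrow> real" and d :: "'i \<Rightarrow> 'i \<Rightarrow> real" and mid :: "'i \<Rightarrow> 'i \<Rightarrow> 'i"
    and valid :: "'i \<Rightarrow> bool" and prec :: "'i \<Rightarrow> 'i \<Rightarrow> bool" and p :: nat
  assumes q0: "\<And>x. valid x \<Longrightarrow> 0 \<le> q x"
    and qmid: "\<And>x y. valid x \<Longrightarrow> valid y \<Longrightarrow> q (mid x y) \<le> (q x + q y) / 2 - d x y"
    and vmid: "\<And>x y. valid x \<Longrightarrow> valid y \<Longrightarrow> valid (mid x y)"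
    and precmid1: "\<And>x y z. prec x z \<Longrightarrow> prec y z \<Longrightarrow> prec (mid x y) z"
    and precmid2: "\<And>x y z. prec z x \<Longrightarrow> prec z y \<Longrightarrow> prec z (mid x y)"
    and "\<And>i. i < p ^ t \<Longrightarrow> valid (x i)" "\<And>i. i < p ^ t \<Longrightarrow> q (x i) < real t * \<delta>"
    and "\<And>i j. i < j \<Longrightarrow> j < p ^ t \<Longrightarrow> prec (x i) (x j)" and p: "0 < p"
  shows "\<exists>y. (\<forall>i<p. valid (y i)) \<and> (\<forall>j<p. \<forall>i<j. prec (y i) (y j) \<and> d (y i) (y j) < \<delta>)"
  using assms(6-8)
proof (induction t arbitrary: x)
  case 0
  \<comment> \<open>For \<open>t = 0\<close> there is one point, and its bound
    \<open>q (x 0) < 0\<close> contradicts \<open>q0\<close>.\<close>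
  from 0(1,2)[of 0] q0[of "x 0"] show ?case by simp
next
  case (Suc t)
  have idx: "k * p + i < p ^ Suc t" if "k < p ^ t" "i < p" for k i
  proof -
    have "k * p + i < Suc k * p" using that by simp
    also have "\<dots> \<le> p ^ t * p" using that by (intro mult_right_mono) auto
    finally show ?thesis by (simp add: mult.commute)
  qed
  show ?case
  proof (cases "\<exists>k<p^t. \<forall>j<p. \<forall>i<j. d (x (k * p + i)) (x (k * p + j)) < \<delta>")
    case True
    then obtain k where k: "k < p ^ t" "\<forall>j<p. \<forall>i<j. d (x (k * p + i)) (x (k * p + j)) < \<delta>" by blast
    show ?thesis
      by (rule exI[of _ "\<lambda>i. x (k * p + i)"]) (use k idx Suc.prems in auto)
  next
    case False
    then have "\<forall>k. \<exists>i j. k < p ^ t \<longrightarrow> i < j \<and> j < p \<and> \<delta> \<le> d (x (k * p + i)) (x (k * p + j))"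
      by (meson not_less)
    then obtain a b where ab: "\<And>k. k < p ^ t \<Longrightarrow> a k < b k \<and> b k < p \<and>
        \<delta> \<le> d (x (k * p + a k)) (x (k * p + b k))" by metis
    define X where "X k = mid (x (k * p + a k)) (x (k * p + b k))" for k
    have lt: "a k < p" "b k < p" if "k < p ^ t" for k using ab[OF that] by auto
    have "valid (X k)" if "k < p ^ t" for k
      unfolding X_def using lt[OF that] that by (intro vmid Suc.prems(1) idx)
    moreover have "q (X k) < real t * \<delta>" if k: "k < p ^ t" for k
    proof -
      have "q (X k) \<le> (q (x (k * p + a k)) + q (x (k * p + b k))) / 2 - d (x (k * p + a k)) (x (k * p + b k))"
        unfolding X_def using lt[OF k] k by (intro qmid Suc.prems(1) idx)
      moreover have "q (x (k * p + a k)) < real (Suc t) * \<delta>" "q (x (k * p + b k)) < real (Suc t) * \<delta>"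
        using lt[OF k] k by (intro Suc.prems(2) idx; simp)+
      moreover have "\<delta> \<le> d (x (k * p + a k)) (x (k * p + b k))" using ab[OF k] by blast
      ultimately show ?thesis by (simp add: algebra_simps)
    qed
    moreover have "prec (X k) (X l)" if kl: "k < l" "l < p ^ t" for k l
    proof -
      have k: "k < p ^ t" using kl by simp
      have "prec (x (k * p + i)) (x (l * p + j))" if "i < p" "j < p" for i j
      proof (rule Suc.prems(3)[OF _ idx])
        have "k * p + i < Suc k * p" using that by simp
        also have "\<dots> \<le> l * p" using kl by (intro mult_right_mono) auto
        finally show "k * p + i < l * p + j" by simp
      qed (use that kl in auto)
      then show ?thesis
        unfolding X_def using lt[OF k] lt[OF kl(2)] by (intro precmid1 precmid2) auto
    qed
    ultimately show ?thesis by (rule Suc.IH)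
  qed
qed

subsection \<open>Selection of frequencies\<close>

text \<open>The pairs \<open>(s\<^sub>0 + (s\<^sub>1 - s\<^sub>2) + \<dots> + (s\<^sub>2\<^sub>m\<^sub>-\<^sub>1 - s\<^sub>2\<^sub>m), s\<^sub>2\<^sub>m)\<close> for decreasing sequences in \<open>S\<close>: these
  sums are the frequencies of the test function.\<close>

inductive_set chain :: "int set \<Rightarrow> (int \<times> int) set" for S where
  start: "s \<in> S \<Longrightarrow> (s, s) \<in> chain S"
| step: "(v, l) \<in> chain S \<Longrightarrow> a \<in> S \<Longrightarrow> b \<in> S \<Longrightarrow> a < l \<Longrightarrow> b < a \<Longrightarrow> (v + a - b, b) \<in> chain S"

lemma chain_ge: "(v, l) \<in> chain S \<Longrightarrow> l \<in> S \<and> l \<le> v"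
  by (induction rule: chain.induct) auto

text \<open>An element below all of \<open>S\<close> can only come last in a decreasing sequence: it
  stands alone or is the final subtracted term.\<close>

lemma chain_insert:
  assumes "\<And>s. s \<in> S \<Longrightarrow> x < s"
  shows "chain (insert x S) \<subseteq> insert (x, x) (chain S \<union> (\<lambda>((v, l), a). (v + a - x, x)) ` (chain S \<times> S))"
proof (rule subrelI)
  fix v l assume "(v, l) \<in> chain (insert x S)"
  then show "(v, l) \<in> insert (x, x) (chain S \<union> (\<lambda>((v, l), a). (v + a - x, x)) ` (chain S \<times> S))"
  proof (induction rule: chain.induct)
    case (start s) then show ?case by (auto intro: chain.start)
  next
    case (step v l a b)
    have xl: "x \<le> b" using step.hyps assms by force
    have a: "a \<in> S" using step.hyps xl by auto
    have l: "l \<noteq> x" using step.hyps xl by auto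
    then have vl: "(v, l) \<in> chain S" using step.IH by auto
    show ?case
    proof (cases "b = x")
      case True then show ?thesis using vl a by force
    next
      case False then show ?thesis using vl a step.hyps by (auto intro: chain.step)
    qed
  qed
qed

text \<open>With \<open>\<Lambda>\<close> the set of frequencies of large coefficients, every
  frequency that a further factor adds to the test function falls where the coefficients of
  \<open>h\<close> are small.\<close>

definition admissible :: "int set \<Rightarrow> int set \<Rightarrow> bool" where
  "admissible \<Lambda> S \<longleftrightarrow>
    (\<forall>v l a b. (v, l) \<in> chain S \<longrightarrow> a \<in> S \<longrightarrow> b \<in> S \<longrightarrow> a < l \<longrightarrow> b < a \<longrightarrow> v + a - b \<notin> \<Lambda>)"

text \<open>Greedy choice, from the top of \<open>\<Lambda>\<close> downwards: each new element has
  to avoid only boundedly many values. The bounds on the chains and on the part of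
  \<open>\<Lambda>\<close> at or above the chosen elements carry the induction; \<open>Q\<close>
  depends on \<open>t\<close> alone.\<close>

lemma exists_admissible:
  fixes t :: nat
  shows "\<exists>Q. \<forall>\<Lambda>. finite \<Lambda> \<longrightarrow> Q \<le> card \<Lambda> \<longrightarrow>
    (\<exists>\<mu>. (\<forall>i<t. \<mu> i \<in> \<Lambda>) \<and> (\<forall>j<t. \<forall>i<j. \<mu> j < \<mu> i) \<and> admissible \<Lambda> (\<mu> ` {..<t}) \<and>
      finite (chain (\<mu> ` {..<t})) \<and> card (chain (\<mu> ` {..<t})) \<le> Q \<and>
      card {y \<in> \<Lambda>. \<exists>i<t. \<mu> i \<le> y} \<le> Q)"
proof (induction t)
  case 0
  have "chain {} = {}" by (metis chain_ge empty_iff ex_in_conv surj_pair)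
  then show ?case by (auto simp: admissible_def)
next
  case (Suc t)
  then obtain Q where Q: "\<And>\<Lambda>. finite \<Lambda> \<Longrightarrow> Q \<le> card \<Lambda> \<Longrightarrow>
    (\<exists>\<mu>. (\<forall>i<t. \<mu> i \<in> \<Lambda>) \<and> (\<forall>j<t. \<forall>i<j. \<mu> j < \<mu> i) \<and> admissible \<Lambda> (\<mu> ` {..<t}) \<and>
      finite (chain (\<mu> ` {..<t})) \<and> card (chain (\<mu> ` {..<t})) \<le> Q \<and>
      card {y \<in> \<Lambda>. \<exists>i<t. \<mu> i \<le> y} \<le> Q)" by blast
  \<comment> \<open>\<open>Q + Q * t * Q\<close> bounds the forbidden values
    \<open>U \<union> X\<close>, \<open>Q * t\<close> the chains that end in the new element, and
    \<open>1\<close> accounts for that element.\<close>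
  define Q' where "Q' = Q + Q * t * Q + Q * t + 1"
  show ?case
  proof (rule exI[of _ Q'], intro allI impI)
    fix \<Lambda> :: "int set" assume fin: "finite \<Lambda>" and card: "Q' \<le> card \<Lambda>"
    have "Q \<le> card \<Lambda>" using card by (simp add: Q'_def)
    then obtain \<mu> where \<mu>: "\<And>i. i < t \<Longrightarrow> \<mu> i \<in> \<Lambda>" "\<And>i j. j < t \<Longrightarrow> i < j \<Longrightarrow> \<mu> j < \<mu> i"
      "admissible \<Lambda> (\<mu> ` {..<t})" "finite (chain (\<mu> ` {..<t}))" "card (chain (\<mu> ` {..<t})) \<le> Q"
      "card {y \<in> \<Lambda>. \<exists>i<t. \<mu> i \<le> y} \<le> Q" using Q[OF fin] by blast
    define S where "S = \<mu> ` {..<t}"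
    have S: "finite S" "card S \<le> t" unfolding S_def using card_image_le[of "{..<t}" \<mu>] by auto
    define U where "U = {y \<in> \<Lambda>. \<exists>i<t. \<mu> i \<le> y}"
    \<comment> \<open>\<open>X\<close> collects the choices of \<open>x\<close> for which some \<open>v + a - x\<close> hits \<open>\<Lambda>\<close>; such a value exceeds the
      last element of \<open>S\<close>, hence lies in \<open>U\<close>.\<close>
    define X where "X = (\<lambda>(((v, l), a), y). v + a - y) ` ((chain S \<times> S) \<times> U)"
    have "card ((chain S \<times> S) \<times> U) \<le> Q * t * Q"
      using \<mu>(5,6) S unfolding card_cartesian_product S_def[symmetric] U_def[symmetric]
      by (intro mult_mono) auto
    moreover have fX: "finite ((chain S \<times> S) \<times> U)"
      using fin \<mu>(4) S by (auto simp: S_def[symmetric] U_def)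
    ultimately have cX: "card X \<le> Q * t * Q" unfolding X_def
      by (meson card_image_le order_trans)
    have finX: "finite X" unfolding X_def using fX by blast
    have cUX: "card (U \<union> X) \<le> Q + Q * t * Q"
      using card_Un_le[of U X] cX \<mu>(6) by (simp add: U_def)
    have "\<Lambda> - (U \<union> X) \<noteq> {}"
    proof
      assume "\<Lambda> - (U \<union> X) = {}"
      then have "card \<Lambda> \<le> card (U \<union> X)"
        using finX fin by (intro card_mono) (auto simp: U_def)
      then show False using cUX card by (simp add: Q'_def)
    qed
    \<comment> \<open>By maximality all of \<open>\<Lambda>\<close> at or above \<open>x\<close>
      lies in \<open>insert x (U \<union> X)\<close>, which keeps the last bound of the
      induction.\<close>
    define x where "x = Max (\<Lambda> - (U \<union> X))"
    have x: "x \<in> \<Lambda> - (U \<union> X)" unfolding x_def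
      using fin \<open>\<Lambda> - (U \<union> X) \<noteq> {}\<close> by (intro Max_in) auto
    have xmax: "y \<le> x" if "y \<in> \<Lambda> - (U \<union> X)" for y
      unfolding x_def using fin that by (intro Max_ge) auto
    have xlt: "x < s" if "s \<in> S" for s
      using x that by (force simp: U_def S_def)
    define \<nu> where "\<nu> = \<mu>(t := x)"
    have im: "\<nu> ` {..<Suc t} = insert x S"
      by (auto simp: \<nu>_def S_def lessThan_Suc)
    have adm: "admissible \<Lambda> (insert x S)"
      unfolding admissible_def
    proof (intro allI impI notI)
      fix v l a b assume h: "(v, l) \<in> chain (insert x S)" "a \<in> insert x S" "b \<in> insert x S" "a < l" "b < a"
        "v + a - b \<in> \<Lambda>"
      have "x \<le> b" using h(3) xlt by force
      have a: "a \<in> S" using h \<open>x \<le> b\<close> by auto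
      have "l \<noteq> x" using h \<open>x \<le> b\<close> by auto
      then have vl: "(v, l) \<in> chain S" using h(1) chain_insert[of S x] xlt by force
      show False
      proof (cases "b = x")
        case False
        then show False using h vl a \<mu>(3) by (auto simp: admissible_def S_def)
      next
        case True
        have "l \<in> S" "l \<le> v" using chain_ge[OF vl] by auto
        then have "v + a - x \<in> U" using h True by (force simp: U_def S_def)
        then have "((((v, l), a), v + a - x)) \<in> (chain S \<times> S) \<times> U" using vl a by simp
        then have "x \<in> X" unfolding X_def by force
        then show False using x by blast
      qed
    qed
    let ?J = "(\<lambda>((v, l), a). (v + a - x, x)) ` (chain S \<times> S)"
    have finJ: "finite ?J" and finC: "finite (chain S)" using \<mu>(4) S by (auto simp: S_def[symmetric])
    have "card ?J \<le> card (chain S \<times> S)" using \<mu>(4) S by (intro card_image_le) (auto simp: S_def[symmetric])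
    also have "\<dots> \<le> Q * t" unfolding card_cartesian_product using \<mu>(5) S
      by (intro mult_mono) (auto simp: S_def)
    finally have cJ: "card ?J \<le> Q * t" .
    have fc: "finite (chain (insert x S))" using chain_insert[of S x, OF xlt] finJ finC
      by (meson finite_Un finite_insert finite_subset)
    have "card (chain (insert x S)) \<le> card (insert (x, x) (chain S \<union> ?J))"
      using finJ finC by (intro card_mono chain_insert xlt) auto
    also have "\<dots> \<le> Suc (card (chain S \<union> ?J))" by (rule card_insert_le_m1) auto
    also have "\<dots> \<le> Suc (Q + Q * t)" using card_Un_le[of "chain S" ?J] cJ \<mu>(5) by (simp add: S_def)
    finally have cc: "card (chain (insert x S)) \<le> Q'" by (simp add: Q'_def)
    have "{y \<in> \<Lambda>. \<exists>i<Suc t. \<nu> i \<le> y} \<subseteq> insert x (U \<union> X)"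
      using xmax by (fastforce simp: \<nu>_def less_Suc_eq U_def)
    then have "card {y \<in> \<Lambda>. \<exists>i<Suc t. \<nu> i \<le> y} \<le> card (insert x (U \<union> X))"
      using finX fin by (intro card_mono) (auto simp: U_def)
    also have "\<dots> \<le> Suc (card (U \<union> X))" by (rule card_insert_le_m1) auto
    finally have cu: "card {y \<in> \<Lambda>. \<exists>i<Suc t. \<nu> i \<le> y} \<le> Q'" using cUX by (simp add: Q'_def)
    show "\<exists>\<mu>. (\<forall>i<Suc t. \<mu> i \<in> \<Lambda>) \<and> (\<forall>j<Suc t. \<forall>i<j. \<mu> j < \<mu> i) \<and> admissible \<Lambda> (\<mu> ` {..<Suc t}) \<and>
      finite (chain (\<mu> ` {..<Suc t})) \<and> card (chain (\<mu> ` {..<Suc t})) \<le> Q' \<and>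
      card {y \<in> \<Lambda>. \<exists>i<Suc t. \<mu> i \<le> y} \<le> Q'"
    proof (intro exI[of _ \<nu>] conjI)
      show "\<forall>i<Suc t. \<nu> i \<in> \<Lambda>" using x \<mu>(1) by (auto simp: \<nu>_def less_Suc_eq)
      show "\<forall>j<Suc t. \<forall>i<j. \<nu> j < \<nu> i" using \<mu>(2) xlt by (auto simp: \<nu>_def less_Suc_eq S_def)
    qed (use adm fc cc cu im in auto)
  qed
qed

subsection \<open>Spectra with a gap\<close>

text \<open>Conjugating every second factor makes the new frequencies enter as differences, and
  turns the product into \<open>z (1 - |z|\<^sup>2)\<^sup>l\<close> when all entries equal
  \<open>z\<close>.\<close>

primrec tprod :: "(nat \<Rightarrow> complex) \<Rightarrow> nat \<Rightarrow> complex" where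
  "tprod z 0 = z 0"
| "tprod z (Suc l) = tprod z l * (1 - z (2 * l + 1) * cnj (z (2 * l + 2)))"

text \<open>Each factor has norm at most 2 and differs from \<open>1 - (norm (z 0))\<^sup>2\<close>
  by at most the two deviations of its entries from \<open>z 0\<close>; the accumulated deviations
  therefore at most double at each step.\<close>

lemma norm_tprod_le:
  assumes "\<And>i. i \<le> 2 * l \<Longrightarrow> norm (z i) \<le> 1"
  shows "norm (tprod z l) \<le> norm (z 0) * (1 - (norm (z 0))\<^sup>2) ^ l + 2 ^ l * (\<Sum>i=1..2*l. norm (z i - z 0))"
  using assms
proof (induction l)
  case (Suc l)
  define x where "x = 1 - (norm (z 0))\<^sup>2"
  define S where "S = (\<Sum>i=1..2*l. norm (z i - z 0))"
  let ?a = "z (2 * l + 1)" and ?b = "z (2 * l + 2)"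
  define D where "D = norm (?a - z 0) + norm (?b - z 0)"
  have n: "norm (z 0) \<le> 1" "norm ?a \<le> 1" "norm ?b \<le> 1" using Suc.prems by auto
  have x: "0 \<le> x" "x \<le> 1" using n(1) by (auto simp: x_def power_le_one)
  have pos: "0 \<le> S" "0 \<le> D" by (auto simp: S_def D_def sum_nonneg)
  have "1 - ?a * cnj ?b = of_real x - (?a - z 0) * cnj ?b - z 0 * cnj (?b - z 0)"
    unfolding x_def by (simp only: of_real_diff of_real_1 complex_norm_square complex_cnj_diff) (simp add: algebra_simps)
  then have "norm (1 - ?a * cnj ?b) = norm (of_real x - (?a - z 0) * cnj ?b - z 0 * cnj (?b - z 0))"
    by (rule arg_cong[of _ _ norm])
  then have "norm (1 - ?a * cnj ?b) \<le> norm (of_real x :: complex) + norm ((?a - z 0) * cnj ?b) + norm (z 0 * cnj (?b - z 0))"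
    using norm_triangle_ineq4[of "of_real x - (?a - z 0) * cnj ?b" "z 0 * cnj (?b - z 0)"]
      norm_triangle_ineq4[of "of_real x" "(?a - z 0) * cnj ?b"] by linarith
  also have "\<dots> \<le> x + D"
    using x n mult_left_mono[OF n(3) norm_ge_zero[of "?a - z 0"]] mult_right_mono[OF n(1) norm_ge_zero[of "?b - z 0"]]
    unfolding norm_mult complex_mod_cnj norm_of_real D_def by (simp only: mult_1_right mult_1_left abs_of_nonneg)
  finally have y1: "norm (1 - ?a * cnj ?b) \<le> x + D" .
  have "norm (1 - ?a * cnj ?b) \<le> norm (1::complex) + norm (?a * cnj ?b)" by (rule norm_triangle_ineq4)
  also have "\<dots> \<le> 2" using mult_mono[OF n(2,3)] by (simp add: norm_mult)
  finally have y2: "norm (1 - ?a * cnj ?b) \<le> 2" .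
  have "norm (tprod z (Suc l)) \<le> (norm (z 0) * x ^ l + 2 ^ l * S) * norm (1 - ?a * cnj ?b)"
    using Suc.IH Suc.prems by (auto simp: norm_mult x_def S_def intro!: mult_right_mono)
  also have "\<dots> = norm (z 0) * x ^ l * norm (1 - ?a * cnj ?b) + 2 ^ l * S * norm (1 - ?a * cnj ?b)"
    by (simp add: distrib_right)
  also have "\<dots> \<le> norm (z 0) * x ^ l * (x + D) + 2 ^ l * S * 2"
    using y1 y2 pos x by (intro add_mono mult_left_mono) auto
  also have "\<dots> = norm (z 0) * x ^ Suc l + norm (z 0) * x ^ l * D + 2 ^ Suc l * S"
    by (simp add: algebra_simps)
  also have "\<dots> \<le> norm (z 0) * x ^ Suc l + 2 ^ Suc l * D + 2 ^ Suc l * S"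
  proof -
    have "norm (z 0) * x ^ l \<le> 1" using n(1) x by (intro mult_le_one power_le_one) auto
    also have "1 \<le> (2::real) ^ Suc l" by (rule one_le_power) simp
    finally have "norm (z 0) * x ^ l * D \<le> 2 ^ Suc l * D" using pos by (intro mult_right_mono) auto
    then show ?thesis by simp
  qed
  also have "\<dots> = norm (z 0) * x ^ Suc l + 2 ^ Suc l * (S + D)" by (simp add: algebra_simps)
  also have "S + D = (\<Sum>i=1..2*Suc l. norm (z i - z 0))" by (simp add: S_def D_def)
  finally show ?case by (simp add: x_def)
qed simp

text \<open>Bernoulli gives \<open>1 + k t\<^sup>2 \<le> (1 + t\<^sup>2)\<^sup>k\<close>, and
  \<open>(1 - t\<^sup>2) (1 + t\<^sup>2) \<le> 1\<close>; the arithmetic-geometric mean inequality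
  bounds \<open>2 * sqrt k * t\<close> by \<open>1 + k t\<^sup>2\<close>.\<close>

lemma mult_power_one_minus_square_le:
  fixes t :: real
  assumes "0 \<le> t" "t \<le> 1" "0 < k"
  shows "t * (1 - t\<^sup>2) ^ k \<le> 1 / (2 * sqrt k)"
proof -
  have t2: "t\<^sup>2 \<le> 1" using assms by (simp add: power_le_one)
  have "(1 - t\<^sup>2) ^ k * (1 + k * t\<^sup>2) \<le> (1 - t\<^sup>2) ^ k * (1 + t\<^sup>2) ^ k"
    using t2 Bernoulli_inequality[of "t\<^sup>2" k] by (intro mult_left_mono) (auto simp: order_trans[of "-1" 0])
  also have "\<dots> = (1 - (t\<^sup>2)\<^sup>2) ^ k"
    by (simp add: power_mult_distrib[symmetric] power2_eq_square algebra_simps)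
  also have "\<dots> \<le> 1" using power_le_one[OF zero_le_power2 t2, of 2] by (intro power_le_one) auto
  finally have 1: "(1 - t\<^sup>2) ^ k * (1 + k * t\<^sup>2) \<le> 1" .
  have "0 \<le> (1 - sqrt k * t)\<^sup>2" by simp
  then have 2: "2 * sqrt k * t \<le> 1 + k * t\<^sup>2"
    by (simp add: power2_eq_square algebra_simps)
  have "(1 - t\<^sup>2) ^ k * (2 * sqrt k * t) \<le> (1 - t\<^sup>2) ^ k * (1 + k * t\<^sup>2)"
    using 2 t2 by (intro mult_left_mono) auto
  with 1 have "(1 - t\<^sup>2) ^ k * (2 * sqrt k * t) \<le> 1" by linarith
  then show ?thesis using assms by (simp add: field_simps)
qed

text \<open>Expanding one more factor adds frequencies \<open>v + a - b\<close> that extend a chain,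
  hence lie outside \<open>\<Lambda>\<close> and contribute at most
  \<open>2 ^ l * \<epsilon>\<close> to the integral. The induction records where chains end, because
  blocks are ordered downwards and the next \<open>a\<close> must lie below that end.\<close>

lemma tprod_spectrum:
  assumes cont: "continuous_on {0..2*pi} h" and adm: "admissible \<Lambda> S"
    and small: "\<And>r. r \<notin> \<Lambda> \<Longrightarrow> norm (fourier_coeff h r) \<le> \<epsilon>"
    and u: "\<And>i. i \<le> 2 * k \<Longrightarrow> expsum (B i) 1 (u i)" and B: "\<And>i. i \<le> 2 * k \<Longrightarrow> B i \<subseteq> S"
    and ord: "\<And>i j a b. j \<le> 2 * k \<Longrightarrow> i < j \<Longrightarrow> a \<in> B i \<Longrightarrow> b \<in> B j \<Longrightarrow> b < a"
    and "l \<le> k" and eps: "0 \<le> \<epsilon>"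
  shows "(\<exists>F. expsum F (2 ^ l) (\<lambda>\<theta>. tprod (\<lambda>i. u i \<theta>) l) \<and>
            (\<forall>v\<in>F. \<exists>b. (v, b) \<in> chain S \<and> b \<in> (\<Union>i\<le>2*l. B i))) \<and>
         norm (integral {0..2*pi} (\<lambda>\<theta>. h \<theta> * tprod (\<lambda>i. u i \<theta>) l) - integral {0..2*pi} (\<lambda>\<theta>. h \<theta> * u 0 \<theta>)) \<le> 2 ^ l * \<epsilon>"
  using \<open>l \<le> k\<close>
proof (induction l)
  case 0
  have "expsum (B 0) (2 ^ 0) (u 0)" using u[of 0] by simp
  moreover have "\<forall>v\<in>B 0. \<exists>b. (v, b) \<in> chain S \<and> b \<in> (\<Union>i\<le>2*0. B i)"
    using B[of 0] by (auto intro: chain.start)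
  ultimately show ?case using eps by auto
next
  case (Suc l)
  let ?T = "\<lambda>\<theta>. tprod (\<lambda>i. u i \<theta>) l"
  let ?a = "u (2 * l + 1)" and ?b = "u (2 * l + 2)"
  obtain F where F: "expsum F (2 ^ l) ?T" "\<And>v. v \<in> F \<Longrightarrow> \<exists>b. (v, b) \<in> chain S \<and> b \<in> (\<Union>i\<le>2*l. B i)"
    using Suc by auto
  have IH: "norm (integral {0..2*pi} (\<lambda>\<theta>. h \<theta> * ?T \<theta>) - integral {0..2*pi} (\<lambda>\<theta>. h \<theta> * u 0 \<theta>)) \<le> 2 ^ l * \<epsilon>"
    using Suc by auto
  have le: "2 * l + 1 \<le> 2 * k" "2 * l + 2 \<le> 2 * k" using Suc.prems by auto
  define G where "G = {f + g |f g. f \<in> F \<and> g \<in> {a + b |a b. a \<in> B (2*l+1) \<and> b \<in> uminus ` B (2*l+2)}}"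
  have "expsum G (2 ^ l * (1 * 1)) (\<lambda>\<theta>. ?T \<theta> * (?a \<theta> * cnj (?b \<theta>)))"
    unfolding G_def by (intro expsum_mult F u le expsum_cnj)
  from expsum_scale[OF this, of "-1"]
  have E: "expsum G (2 ^ l) (\<lambda>\<theta>. - (?T \<theta> * (?a \<theta> * cnj (?b \<theta>))))" by simp
  have GS: "\<exists>b. (v, b) \<in> chain S \<and> b \<in> B (2*l+2)" and GL: "v \<notin> \<Lambda>" if "v \<in> G" for v
  proof -
    obtain f a b where v: "v = f + a - b" "f \<in> F" "a \<in> B (2*l+1)" "b \<in> B (2*l+2)"
      using \<open>v \<in> G\<close> unfolding G_def by force
    obtain l' i where l': "(f, l') \<in> chain S" "i \<le> 2 * l" "l' \<in> B i" using F(2)[OF v(2)] by auto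
    have "a < l'" using ord[of "2*l+1" i] l' v le by auto
    moreover have "b < a" using ord[of "2*l+2" "2*l+1"] v le by auto
    moreover have "a \<in> S" "b \<in> S" using B le v by blast+
    ultimately show "\<exists>b. (v, b) \<in> chain S \<and> b \<in> B (2*l+2)" "v \<notin> \<Lambda>"
      using chain.step[OF l'(1)] adm l'(1) v unfolding admissible_def by blast+
  qed
  have eq: "tprod (\<lambda>i. u i \<theta>) (Suc l) = ?T \<theta> + - (?T \<theta> * (?a \<theta> * cnj (?b \<theta>)))" for \<theta>
    by (simp add: algebra_simps)
  have "expsum (F \<union> G) (2 ^ l + 2 ^ l) (\<lambda>\<theta>. tprod (\<lambda>i. u i \<theta>) (Suc l))"
    unfolding eq by (intro expsum.add expsum_mono[OF F(1)] expsum_mono[OF E]) auto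
  then have "expsum (F \<union> G) (2 ^ Suc l) (\<lambda>\<theta>. tprod (\<lambda>i. u i \<theta>) (Suc l))"
    by (simp only: power_Suc mult_2)
  moreover have "\<exists>b. (v, b) \<in> chain S \<and> b \<in> (\<Union>i\<le>2*Suc l. B i)" if v: "v \<in> F \<union> G" for v
  proof -
    from v show ?thesis
    proof
      assume "v \<in> F"
      then obtain b i where "(v, b) \<in> chain S" "i \<le> 2 * l" "b \<in> B i" using F(2) by blast
      then show ?thesis by (intro exI[of _ b] conjI UN_I[of i]) auto
    next
      assume "v \<in> G"
      then obtain b where "(v, b) \<in> chain S" "b \<in> B (2 * l + 2)" using GS by blast
      then show ?thesis by (intro exI[of _ b] conjI UN_I[of "2 * l + 2"]) auto
    qed
  qed
  moreover have "norm (integral {0..2*pi} (\<lambda>\<theta>. h \<theta> * tprod (\<lambda>i. u i \<theta>) (Suc l)) - integral {0..2*pi} (\<lambda>\<theta>. h \<theta> * u 0 \<theta>)) \<le> 2 ^ Suc l * \<epsilon>"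
  proof -
    have small': "norm (integral {0..2*pi} (\<lambda>\<theta>. h \<theta> * - (?T \<theta> * (?a \<theta> * cnj (?b \<theta>))))) \<le> \<epsilon> * 2 ^ l"
      by (rule expsum_pairing[OF E cont]) (use small GL in auto)
    have "integral {0..2*pi} (\<lambda>\<theta>. h \<theta> * tprod (\<lambda>i. u i \<theta>) (Suc l))
       = integral {0..2*pi} (\<lambda>\<theta>. h \<theta> * ?T \<theta>) + integral {0..2*pi} (\<lambda>\<theta>. h \<theta> * - (?T \<theta> * (?a \<theta> * cnj (?b \<theta>))))"
      unfolding eq distrib_left
      by (intro integral_add integrable_continuous_interval continuous_intros cont
            expsum_continuous[OF F(1)] expsum_continuous[OF u] le)
    then have "integral {0..2*pi} (\<lambda>\<theta>. h \<theta> * tprod (\<lambda>i. u i \<theta>) (Suc l)) - integral {0..2*pi} (\<lambda>\<theta>. h \<theta> * u 0 \<theta>) =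
        (integral {0..2*pi} (\<lambda>\<theta>. h \<theta> * ?T \<theta>) - integral {0..2*pi} (\<lambda>\<theta>. h \<theta> * u 0 \<theta>))
          + integral {0..2*pi} (\<lambda>\<theta>. h \<theta> * - (?T \<theta> * (?a \<theta> * cnj (?b \<theta>))))"
      by (simp only:) simp
    moreover have "2 ^ Suc l * \<epsilon> = 2 ^ l * \<epsilon> + \<epsilon> * 2 ^ l" by simp
    ultimately show ?thesis using norm_triangle_mono[OF IH small'] by (simp only:)
  qed
  ultimately show ?case by blast
qed

section \<open>Bounding the number of large Fourier coefficients\<close>

text \<open>Pointwise \<open>|v| \<le> (\<eta> + |v|\<^sup>2 / \<eta>) / 2\<close>. This replaces
  Cauchy-Schwarz in passing from closeness in weighted \<open>L\<^sup>2\<close> to closeness in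
  weighted \<open>L\<^sup>1\<close>.\<close>

lemma integral_weighted_le:
  fixes W g :: "real \<Rightarrow> real"
  assumes W: "continuous_on {0..2*pi} W" "\<And>x. 0 \<le> W x" and v: "continuous_on {0..2*pi} v" and eta: "0 < \<eta>"
  shows "integral {0..2*pi} (\<lambda>x. W x * norm (v x :: complex)) \<le>
    (\<eta> * integral {0..2*pi} W + integral {0..2*pi} (\<lambda>x. W x * (norm (v x))\<^sup>2) / \<eta>) / 2"
proof -
  have "integral {0..2*pi} (\<lambda>x. W x * norm (v x)) \<le> integral {0..2*pi} (\<lambda>x. (\<eta> / 2) * W x + (W x * (norm (v x))\<^sup>2) * (1 / (2 * \<eta>)))"
  proof (rule integral_le)
    fix x
    have "0 \<le> (\<eta> - norm (v x))\<^sup>2" by simp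
    then have "norm (v x) \<le> \<eta> / 2 + (norm (v x))\<^sup>2 * (1 / (2 * \<eta>))"
      using eta by (simp add: field_simps power2_eq_square)
    from mult_left_mono[OF this W(2)[of x]]
    show "W x * norm (v x) \<le> (\<eta> / 2) * W x + (W x * (norm (v x))\<^sup>2) * (1 / (2 * \<eta>))"
      by (simp add: algebra_simps)
  qed (intro integrable_continuous_interval continuous_intros W v)+
  also have "\<dots> = integral {0..2*pi} (\<lambda>x. (\<eta> / 2) * W x) + integral {0..2*pi} (\<lambda>x. (W x * (norm (v x))\<^sup>2) * (1 / (2 * \<eta>)))"
    by (intro integral_add integrable_continuous_interval continuous_intros W v)
  also have "\<dots> = (\<eta> * integral {0..2*pi} W + integral {0..2*pi} (\<lambda>x. W x * (norm (v x))\<^sup>2) / \<eta>) / 2"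
    by (simp add: field_simps)
  finally show ?thesis .
qed

text \<open>With too many large coefficients, the test function \<open>tprod\<close> pairs with
  \<open>h\<close> to within \<open>c / 4\<close> of a number of modulus at least \<open>c\<close>,
  yet its pairing has modulus at most \<open>c / 4 + c / 4\<close>.\<close>

lemma large_spectrum_bounded:
  fixes C c :: real
  assumes c: "0 < c"
  shows "\<exists>N \<epsilon>. 0 < \<epsilon> \<and> (\<forall>h. continuous_on {0..2*pi} h \<longrightarrow>
     integral {0..2*pi} (\<lambda>\<theta>. norm (h \<theta>)) \<le> C \<longrightarrow>
     (\<forall>r. c \<le> norm (fourier_coeff h r) \<or> norm (fourier_coeff h r) \<le> \<epsilon>) \<longrightarrow>
     finite {r. c \<le> norm (fourier_coeff h r)} \<longrightarrow> card {r. c \<le> norm (fourier_coeff h r)} \<le> N)"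
proof -
  define C1 where "C1 = max C 1"
  have C1: "0 < C1" "C \<le> C1" by (auto simp: C1_def)
  \<comment> \<open>\<open>k\<close> is so large that the main term of \<open>norm_tprod_le\<close>,
    at most \<open>1 / (2 * sqrt k)\<close>, integrates to at most \<open>c / 4\<close>.\<close>
  obtain k :: nat where k0: "(2 * C1 / c)\<^sup>2 < real k" using reals_Archimedean2 by blast
  have k: "0 < k" using k0 by (metis gr0I not_less of_nat_0 zero_le_power2)
  have "2 * C1 / c < sqrt k" using k0 c C1 by (intro real_less_rsqrt) auto
  then have kC: "C1 * (1 / (2 * sqrt k)) \<le> c / 4" using k c by (simp add: field_simps)
  define p where "p = 2 * k + 1"
  \<comment> \<open>\<open>M\<close> is the weight \<open>2 ^ k\<close> of a deviation times the
    number \<open>2 * k\<close> of deviations. \<open>\<eta>\<close> and \<open>\<delta>\<close>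
    solve \<open>\<eta> * C1 = 4 * \<delta> / \<eta> = c / (4 * M)\<close>, so each deviation
    integrates to at most \<open>c / (4 * M)\<close>.\<close>
  define M where "M = 2 ^ k * (2 * real k)"
  have M: "0 < M" using k by (simp add: M_def)
  define \<eta> where "\<eta> = c / (4 * M * C1)"
  have \<eta>: "0 < \<eta>" using c M C1 by (simp add: \<eta>_def)
  define \<delta> where "\<delta> = c * \<eta> / (16 * M)"
  have \<delta>: "0 < \<delta>" using c M \<eta> by (simp add: \<delta>_def)
  \<comment> \<open>Every energy \<open>q\<close> below is at most \<open>C1\<close>, so
    \<open>t\<close> decrements by \<open>\<delta>\<close> are impossible.\<close>
  obtain t :: nat where "C1 / \<delta> < real t" using reals_Archimedean2 by blast
  then have t: "C1 < real t * \<delta>" using \<delta> by (simp add: field_simps)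
  have "\<exists>Q. \<forall>\<Lambda>. finite \<Lambda> \<longrightarrow> Q \<le> card \<Lambda> \<longrightarrow>
    (\<exists>\<mu>. (\<forall>i<p^t. \<mu> i \<in> \<Lambda>) \<and> (\<forall>j<p^t. \<forall>i<j. \<mu> j < \<mu> i) \<and> admissible \<Lambda> (\<mu> ` {..<p^t}))"
    using exists_admissible[of "p ^ t"]
    by (elim ex_forward all_forward imp_forward) (assumption | elim conjE, intro conjI)+
  then obtain Q where Q: "\<And>\<Lambda>. finite \<Lambda> \<Longrightarrow> Q \<le> card \<Lambda> \<Longrightarrow>
    (\<exists>\<mu>. (\<forall>i<p^t. \<mu> i \<in> \<Lambda>) \<and> (\<forall>j<p^t. \<forall>i<j. \<mu> j < \<mu> i) \<and> admissible \<Lambda> (\<mu> ` {..<p^t}))"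
    by blast
  define \<epsilon> where "\<epsilon> = c / (4 * 2 ^ k)"
  have \<epsilon>: "0 < \<epsilon>" using c by (simp add: \<epsilon>_def)
  have "card {r. c \<le> norm (fourier_coeff h r)} \<le> Q"
    if cont: "continuous_on {0..2*pi} h" and L1: "integral {0..2*pi} (\<lambda>\<theta>. norm (h \<theta>)) \<le> C"
      and dich: "\<And>r. c \<le> norm (fourier_coeff h r) \<or> norm (fourier_coeff h r) \<le> \<epsilon>"
      and fin: "finite {r. c \<le> norm (fourier_coeff h r)}" for h
  proof (rule ccontr)
    assume neg: "\<not> ?thesis"
    define \<Lambda> where "\<Lambda> = {r. c \<le> norm (fourier_coeff h r)}"
    define W where "W \<theta> = norm (h \<theta>)" for \<theta>
    have W: "continuous_on {0..2*pi} W" "0 \<le> W \<theta>" for \<theta>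
      unfolding W_def by (intro continuous_intros cont) auto
    have WC: "integral {0..2*pi} W \<le> C1" using L1 C1 by (simp add: W_def[abs_def])
    obtain \<mu> where \<mu>: "\<And>i. i < p^t \<Longrightarrow> \<mu> i \<in> \<Lambda>" "\<And>i j. j < p^t \<Longrightarrow> i < j \<Longrightarrow> \<mu> j < \<mu> i"
        "admissible \<Lambda> (\<mu> ` {..<p^t})"
      using Q[of \<Lambda>] fin neg unfolding \<Lambda>_def by (metis nle_le)
    define S where "S = \<mu> ` {..<p^t}"
    define pair where "pair u = integral {0..2*pi} (\<lambda>\<theta>. h \<theta> * u \<theta>)" for u :: "real \<Rightarrow> complex"
    \<comment> \<open>The points of the energy argument are functions together with their frequency
      sets. Averages stay valid because the condition on the real part of the pairing is
      convex.\<close>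
    define valid where "valid x \<longleftrightarrow> fst x \<subseteq> S \<and> expsum (fst x) 1 (snd x) \<and> c \<le> Re (pair (snd x))"
      for x :: "int set \<times> (real \<Rightarrow> complex)"
    define mid where "mid x y = (fst x \<union> fst y, \<lambda>\<theta>. (1/2) * snd x \<theta> + (1/2) * snd y \<theta>)"
      for x y :: "int set \<times> (real \<Rightarrow> complex)"
    define prec where "prec x y \<longleftrightarrow> (\<forall>a\<in>fst x. \<forall>b\<in>fst y. b < a)"
      for x y :: "int set \<times> (real \<Rightarrow> complex)"
    define q where "q x = integral {0..2*pi} (\<lambda>\<theta>. W \<theta> * (norm (snd x \<theta>))\<^sup>2)"
      for x :: "int set \<times> (real \<Rightarrow> complex)"
    \<comment> \<open>The quarter comes from the parallelogram identity for the midpoint.\<close>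
    define d where "d x y = integral {0..2*pi} (\<lambda>\<theta>. W \<theta> * (norm (snd x \<theta> - snd y \<theta>))\<^sup>2) / 4"
      for x y :: "int set \<times> (real \<Rightarrow> complex)"
    have vcont: "continuous_on {0..2*pi} (snd x)" if "valid x" for x
      using that expsum_continuous by (auto simp: valid_def)
    have q0: "0 \<le> q x" if "valid x" for x
      unfolding q_def using that W by (intro integral_nonneg integrable_continuous_interval continuous_intros vcont) auto
    have qmid: "q (mid x y) \<le> (q x + q y) / 2 - d x y" if "valid x" "valid y" for x y
    proof -
      note i = integrable_continuous_interval continuous_intros W(1) vcont that
      have "q (mid x y) = integral {0..2*pi} (\<lambda>\<theta>. (1/2) * (W \<theta> * (norm (snd x \<theta>))\<^sup>2) + (1/2) * (W \<theta> * (norm (snd y \<theta>))\<^sup>2)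
             - (1/4) * (W \<theta> * (norm (snd x \<theta> - snd y \<theta>))\<^sup>2))"
      proof -
        have "W \<theta> * (norm ((1/2) * z + (1/2) * w))\<^sup>2 = (1/2) * (W \<theta> * (norm z)\<^sup>2) + (1/2) * (W \<theta> * (norm w)\<^sup>2)
             - (1/4) * (W \<theta> * (norm (z - w))\<^sup>2)" for \<theta> and z w :: complex
        proof -
          have "(norm (z + w))\<^sup>2 = 2 * (norm z)\<^sup>2 + 2 * (norm w)\<^sup>2 - (norm (z - w))\<^sup>2"
            unfolding cmod_power2 by (simp add: algebra_simps power2_eq_square)
          then have "(norm ((1/2) * z + (1/2) * w))\<^sup>2 = (1/2) * (norm z)\<^sup>2 + (1/2) * (norm w)\<^sup>2 - (1/4) * (norm (z - w))\<^sup>2"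
            unfolding distrib_left[symmetric] norm_mult power_mult_distrib by (simp add: power_divide field_simps)
          then show ?thesis by (simp only:) (simp add: algebra_simps)
        qed
        then show ?thesis by (simp only: q_def mid_def snd_conv)
      qed
      also have "\<dots> = integral {0..2*pi} (\<lambda>\<theta>. (1/2) * (W \<theta> * (norm (snd x \<theta>))\<^sup>2) + (1/2) * (W \<theta> * (norm (snd y \<theta>))\<^sup>2))
             - integral {0..2*pi} (\<lambda>\<theta>. (1/4) * (W \<theta> * (norm (snd x \<theta> - snd y \<theta>))\<^sup>2))"
        by (intro integral_diff i)
      also have "integral {0..2*pi} (\<lambda>\<theta>. (1/2) * (W \<theta> * (norm (snd x \<theta>))\<^sup>2) + (1/2) * (W \<theta> * (norm (snd y \<theta>))\<^sup>2))
        = integral {0..2*pi} (\<lambda>\<theta>. (1/2) * (W \<theta> * (norm (snd x \<theta>))\<^sup>2)) + integral {0..2*pi} (\<lambda>\<theta>. (1/2) * (W \<theta> * (norm (snd y \<theta>))\<^sup>2))"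
        by (intro integral_add i)
      finally show ?thesis unfolding integral_mult_right q_def d_def by (simp add: field_simps)
    qed
    have vmid: "valid (mid x y)" if "valid x" "valid y" for x y
    proof -
      have "expsum (fst x \<union> fst y) (norm (1/2 :: complex) * 1 + norm (1/2 :: complex) * 1) (snd (mid x y))"
        unfolding mid_def snd_conv using that unfolding valid_def
        by (intro expsum.add expsum_scale) (auto elim: expsum_mono)
      moreover have "pair (snd (mid x y)) = (1/2) * pair (snd x) + (1/2) * pair (snd y)"
      proof -
        have "pair (snd (mid x y)) = integral {0..2*pi} (\<lambda>\<theta>. (1/2) * (h \<theta> * snd x \<theta>) + (1/2) * (h \<theta> * snd y \<theta>))"
          by (simp add: pair_def mid_def algebra_simps)
        also have "\<dots> = integral {0..2*pi} (\<lambda>\<theta>. (1/2) * (h \<theta> * snd x \<theta>)) + integral {0..2*pi} (\<lambda>\<theta>. (1/2) * (h \<theta> * snd y \<theta>))"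
          by (intro integral_add integrable_continuous_interval continuous_intros cont vcont that)
        finally show ?thesis unfolding integral_mult_right pair_def .
      qed
      ultimately show ?thesis using that by (auto simp: valid_def mid_def)
    qed
    \<comment> \<open>The conjugate phase makes the pairing of \<open>h\<close> with this
      exponential equal to the modulus of the coefficient.\<close>
    define x where "x i = ({\<mu> i}, \<lambda>\<theta>. cnj (sgn (fourier_coeff h (\<mu> i))) * cis (- (of_int (\<mu> i) * \<theta>)))" for i
    have xv: "valid (x i)" if "i < p ^ t" for i
    proof -
      have big: "c \<le> norm (fourier_coeff h (\<mu> i))" using \<mu>(1)[OF that] by (simp add: \<Lambda>_def)
      have "pair (snd (x i)) = cnj (sgn (fourier_coeff h (\<mu> i))) * fourier_coeff h (\<mu> i)"
        unfolding pair_def fourier_coeff_def integral_mult_right[symmetric] by (simp add: x_def fourier_coeff_def mult_ac)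
      also have "\<dots> = of_real (norm (fourier_coeff h (\<mu> i)))"
        using complex_norm_square[of "fourier_coeff h (\<mu> i)"]
        by (cases "fourier_coeff h (\<mu> i) = 0") (auto simp: sgn_eq field_simps power2_eq_square)
      finally have "c \<le> Re (pair (snd (x i)))" using big by simp
      moreover have "expsum (fst (x i)) 1 (snd (x i))"
        unfolding x_def fst_conv snd_conv by (intro expsum.single) (auto simp: norm_sgn)
      moreover have "fst (x i) \<subseteq> S" using that by (auto simp: x_def S_def)
      ultimately show ?thesis by (simp add: valid_def)
    qed
    have qle: "q z < real t * \<delta>" if "valid z" for z
    proof -
      have n: "norm (snd z \<theta>) \<le> 1" for \<theta> using that expsum_norm_le by (auto simp: valid_def)
      have "q z \<le> integral {0..2*pi} W" unfolding q_def
      proof (rule integral_le)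
        fix \<theta> show "W \<theta> * (norm (snd z \<theta>))\<^sup>2 \<le> W \<theta>"
          using n[of \<theta>] W(2)[of \<theta>] by (simp add: mult_left_le power_le_one)
      qed (intro integrable_continuous_interval continuous_intros W(1) vcont that)+
      then show ?thesis using WC t by linarith
    qed
    have "\<exists>y. (\<forall>i<p. valid (y i)) \<and> (\<forall>j<p. \<forall>i<j. prec (y i) (y j) \<and> d (y i) (y j) < \<delta>)"
    proof (rule energy_decrement[where mid = mid and q = q and x = x and t = t])
      show "prec (x i) (x j)" if "i < j" "j < p ^ t" for i j
        using \<mu>(2)[OF that(2,1)] by (simp add: prec_def x_def)
    qed (use q0 qmid vmid xv qle in \<open>auto simp: prec_def mid_def p_def\<close>)
    then obtain y where y: "\<And>i. i < p \<Longrightarrow> valid (y i)"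
      "\<And>i j. j < p \<Longrightarrow> i < j \<Longrightarrow> prec (y i) (y j) \<and> d (y i) (y j) < \<delta>" by blast
    define u where "u i = snd (y i)" for i
    define B where "B i = fst (y i)" for i
    have u: "expsum (B i) 1 (u i)" "B i \<subseteq> S" "continuous_on {0..2*pi} (u i)" "norm (u i \<theta>) \<le> 1"
      if "i \<le> 2 * k" for i \<theta>
      using y(1)[of i] that vcont[of "y i"] expsum_norm_le by (auto simp: valid_def u_def B_def p_def)
    have ord: "b < a" if "j \<le> 2 * k" "i < j" "a \<in> B i" "b \<in> B j" for i j a b
      using y(2)[of j i] that by (auto simp: prec_def B_def p_def)
    let ?T = "\<lambda>\<theta>. tprod (\<lambda>i. u i \<theta>) k"
    have small: "norm (fourier_coeff h r) \<le> \<epsilon>" if "r \<notin> \<Lambda>" for r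
      using dich[of r] that by (auto simp: \<Lambda>_def)
    have adm: "admissible \<Lambda> S" using \<mu>(3) by (simp add: S_def)
    have "(\<exists>F. expsum F (2 ^ k) ?T \<and> (\<forall>v\<in>F. \<exists>b. (v, b) \<in> chain S \<and> b \<in> (\<Union>i\<le>2*k. B i))) \<and>
         norm (integral {0..2*pi} (\<lambda>\<theta>. h \<theta> * ?T \<theta>) - integral {0..2*pi} (\<lambda>\<theta>. h \<theta> * u 0 \<theta>)) \<le> 2 ^ k * \<epsilon>"
      by (rule tprod_spectrum[OF cont adm small u(1,2) ord order_refl less_imp_le[OF \<epsilon>]])
    then obtain F where T: "expsum F (2 ^ k) ?T" and close: "norm (pair ?T - pair (u 0)) \<le> c / 4"
      by (auto simp: pair_def \<epsilon>_def)
    have Tcont: "continuous_on {0..2*pi} ?T" by (rule expsum_continuous[OF T])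
    have "c \<le> Re (pair (u 0))" using y(1)[of 0] by (simp add: valid_def u_def p_def)
    also have "\<dots> \<le> norm (pair (u 0))" by (rule complex_Re_le_cmod)
    also have "\<dots> \<le> norm (pair ?T) + c / 4"
      using close norm_triangle_sub[of "pair (u 0)" "pair ?T"] by (simp add: norm_minus_commute)
    also have "norm (pair ?T) \<le> integral {0..2*pi} (\<lambda>\<theta>. W \<theta> * norm (?T \<theta>))"
      unfolding pair_def W_def norm_mult[symmetric]
      by (intro integral_norm_bound_integral integrable_continuous_interval continuous_intros cont Tcont) auto
    also have "\<dots> \<le> integral {0..2*pi} (\<lambda>\<theta>. W \<theta> * (1 / (2 * sqrt k)) + 2 ^ k * (\<Sum>i=1..2*k. W \<theta> * norm (u i \<theta> - u 0 \<theta>)))"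
    proof (rule integral_le)
      fix \<theta>
      have "norm (?T \<theta>) \<le> norm (u 0 \<theta>) * (1 - (norm (u 0 \<theta>))\<^sup>2) ^ k + 2 ^ k * (\<Sum>i=1..2*k. norm (u i \<theta> - u 0 \<theta>))"
        by (rule norm_tprod_le) (use u(4) in auto)
      also have "\<dots> \<le> 1 / (2 * sqrt k) + 2 ^ k * (\<Sum>i=1..2*k. norm (u i \<theta> - u 0 \<theta>))"
        using mult_power_one_minus_square_le[of "norm (u 0 \<theta>)" k] u(4)[of 0 \<theta>] k by auto
      finally have "norm (?T \<theta>) \<le> 1 / (2 * sqrt k) + 2 ^ k * (\<Sum>i=1..2*k. norm (u i \<theta> - u 0 \<theta>))" .
      from mult_left_mono[OF this W(2)[of \<theta>]]
      show "W \<theta> * norm (?T \<theta>) \<le> W \<theta> * (1 / (2 * sqrt k)) + 2 ^ k * (\<Sum>i=1..2*k. W \<theta> * norm (u i \<theta> - u 0 \<theta>))"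
        by (simp only: distrib_left sum_distrib_left mult.left_commute[of "W \<theta>"])
    qed (intro integrable_continuous_interval continuous_intros W(1) Tcont u(3); simp)+
    also have "\<dots> = integral {0..2*pi} W * (1 / (2 * sqrt k)) + 2 ^ k * (\<Sum>i=1..2*k. integral {0..2*pi} (\<lambda>\<theta>. W \<theta> * norm (u i \<theta> - u 0 \<theta>)))"
    proof -
      have "integral {0..2*pi} (\<lambda>\<theta>. W \<theta> * (1 / (2 * sqrt k)) + 2 ^ k * (\<Sum>i=1..2*k. W \<theta> * norm (u i \<theta> - u 0 \<theta>)))
        = integral {0..2*pi} (\<lambda>\<theta>. W \<theta> * (1 / (2 * sqrt k))) + integral {0..2*pi} (\<lambda>\<theta>. 2 ^ k * (\<Sum>i=1..2*k. W \<theta> * norm (u i \<theta> - u 0 \<theta>)))"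
        by (intro integral_add integrable_continuous_interval continuous_intros W(1) u(3)) auto
      also have "integral {0..2*pi} (\<lambda>\<theta>. \<Sum>i=1..2*k. W \<theta> * norm (u i \<theta> - u 0 \<theta>)) = (\<Sum>i=1..2*k. integral {0..2*pi} (\<lambda>\<theta>. W \<theta> * norm (u i \<theta> - u 0 \<theta>)))"
        by (intro integral_sum integrable_continuous_interval continuous_intros W(1) u(3)) auto
      then have "integral {0..2*pi} (\<lambda>\<theta>. 2 ^ k * (\<Sum>i=1..2*k. W \<theta> * norm (u i \<theta> - u 0 \<theta>)))
        = 2 ^ k * (\<Sum>i=1..2*k. integral {0..2*pi} (\<lambda>\<theta>. W \<theta> * norm (u i \<theta> - u 0 \<theta>)))"
        by (simp only: integral_mult_right)
      finally show ?thesis by (simp only: integral_mult_left)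
    qed
    also have "\<dots> \<le> c / 4 + c / 4"
    proof (rule add_mono)
      show "integral {0..2*pi} W * (1 / (2 * sqrt k)) \<le> c / 4"
        using mult_right_mono[OF WC, of "1 / (2 * sqrt k)"] kC by simp
      have "integral {0..2*pi} (\<lambda>\<theta>. W \<theta> * norm (u i \<theta> - u 0 \<theta>)) \<le> c / (4 * M)" if i: "i \<in> {1..2*k}" for i
      proof -
        have "d (y 0) (y i) < \<delta>" using y(2)[of i 0] i by (simp add: p_def)
        then have D: "integral {0..2*pi} (\<lambda>\<theta>. W \<theta> * (norm (u i \<theta> - u 0 \<theta>))\<^sup>2) \<le> 4 * \<delta>"
          by (simp add: d_def u_def norm_minus_commute)
        have "integral {0..2*pi} (\<lambda>\<theta>. W \<theta> * norm (u i \<theta> - u 0 \<theta>)) \<le>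
          (\<eta> * integral {0..2*pi} W + integral {0..2*pi} (\<lambda>\<theta>. W \<theta> * (norm (u i \<theta> - u 0 \<theta>))\<^sup>2) / \<eta>) / 2"
          using i by (intro integral_weighted_le W \<eta> continuous_intros u(3)) auto
        also have "\<dots> \<le> (\<eta> * C1 + (4 * \<delta>) / \<eta>) / 2"
          using D WC \<eta> by (intro divide_right_mono add_mono mult_left_mono) auto
        also have "\<dots> = c / (4 * M)"
          using \<eta> C1 M c by (simp add: \<delta>_def) (simp add: \<eta>_def field_simps)
        finally show ?thesis .
      qed
      then have "(\<Sum>i=1..2*k. integral {0..2*pi} (\<lambda>\<theta>. W \<theta> * norm (u i \<theta> - u 0 \<theta>))) \<le> (\<Sum>i=1..2*k. c / (4 * M))"
        by (rule sum_mono)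
      then have "2 ^ k * (\<Sum>i=1..2*k. integral {0..2*pi} (\<lambda>\<theta>. W \<theta> * norm (u i \<theta> - u 0 \<theta>))) \<le> 2 ^ k * (\<Sum>i=1..2*k. c / (4 * M))"
        by (rule mult_left_mono) simp
      also have "\<dots> = M * (c / (4 * M))" by (simp add: M_def)
      also have "\<dots> = c / 4" using M by simp
      finally show "2 ^ k * (\<Sum>i=1..2*k. integral {0..2*pi} (\<lambda>\<theta>. W \<theta> * norm (u i \<theta> - u 0 \<theta>))) \<le> c / 4" .
    qed
    finally show False using c by linarith
  qed
  then show ?thesis using \<epsilon> by blast
qed

subsection \<open>Multipliers for sign changes\<close>

lemma constant_sign:
  fixes f :: "real \<Rightarrow> real"
  assumes f: "continuous_on {a..b} f" and nz: "\<And>x. a < x \<Longrightarrow> x < b \<Longrightarrow> f x \<noteq> 0"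
  shows "\<exists>s\<in>{-1, 1}. \<forall>x\<in>{a..b}. 0 \<le> s * f x"
proof (rule ccontr)
  assume neg: "\<not> ?thesis"
  then have "\<not> (\<forall>x\<in>{a..b}. 0 \<le> 1 * f x)" by blast
  then obtain x where x: "a \<le> x" "x \<le> b" "f x < 0" by auto
  from neg have "\<not> (\<forall>x\<in>{a..b}. 0 \<le> - 1 * f x)" by blast
  then obtain y where y: "a \<le> y" "y \<le> b" "0 < f y" by auto
  have "\<exists>z\<in>{min x y..max x y}. f z = 0"
  proof (cases "x \<le> y")
    case True
    then show ?thesis using IVT'[of f x 0 y] x y continuous_on_subset[OF f, of "{x..y}"] by auto
  next
    case False
    then show ?thesis using IVT2'[of f x 0 y] x y continuous_on_subset[OF f, of "{y..x}"] by auto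
  qed
  then obtain z where z: "min x y \<le> z" "z \<le> max x y" "f z = 0" by auto
  then have "z \<noteq> x" "z \<noteq> y" using x y by auto
  then show False using nz[of z] z x y by (auto simp: min_def max_def split: if_splits)
qed

text \<open>Induction on the largest point \<open>t\<close> of \<open>Z\<close>: to the right of
  \<open>t\<close> the function has one sign, and \<open>t\<close> joins \<open>J\<close> when this
  sign differs from the one found on the left. The zeros are only required in \<open>Z\<close> for
  \<open>x < b\<close>, so that the hypothesis survives shortening the interval to end at
  \<open>t\<close>.\<close>

lemma sign_pattern:
  fixes f :: "real \<Rightarrow> real"
  assumes "finite Z" "continuous_on {a..b} f" "Z \<subseteq> {a..b}" "\<And>x. a \<le> x \<Longrightarrow> x < b \<Longrightarrow> f x = 0 \<Longrightarrow> x \<in> Z"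
  shows "\<exists>J\<subseteq>Z. \<exists>s\<in>{-1, 1}. \<forall>x\<in>{a..b}. 0 \<le> s * f x * (\<Prod>t\<in>J. x - t)"
  using assms
proof (induction Z arbitrary: b rule: finite_linorder_max_induct)
  case empty
  then have "\<exists>s\<in>{-1, 1}. \<forall>x\<in>{a..b}. 0 \<le> s * f x"
    by (intro constant_sign) (auto dest: less_imp_le)
  then show ?case by simp
next
  case (insert t Z)
  have t: "a \<le> t" "t \<le> b" using insert.prems by auto
  have "\<exists>J\<subseteq>Z. \<exists>s\<in>{-1, 1}. \<forall>x\<in>{a..t}. 0 \<le> s * f x * (\<Prod>t\<in>J. x - t)"
  proof (rule insert.IH)
    show "continuous_on {a..t} f" using insert.prems(1) t by (elim continuous_on_subset) auto
    show "Z \<subseteq> {a..t}" using insert.prems(2) insert.hyps by (auto simp: less_imp_le)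
    show "x \<in> Z" if "a \<le> x" "x < t" "f x = 0" for x using insert.prems(3)[of x] that t by auto
  qed
  then obtain J s where J: "J \<subseteq> Z" "s \<in> {-1, 1}" "\<And>x. a \<le> x \<Longrightarrow> x \<le> t \<Longrightarrow> 0 \<le> s * f x * (\<Prod>t\<in>J. x - t)"
    by (metis atLeastAtMost_iff)
  have "\<exists>s\<in>{-1, 1}. \<forall>x\<in>{t..b}. 0 \<le> s * f x"
  proof (rule constant_sign)
    show "continuous_on {t..b} f" using insert.prems(1) t by (elim continuous_on_subset) auto
    show "f x \<noteq> 0" if "t < x" "x < b" for x using insert.prems(3)[of x] insert.hyps(2) that t by force
  qed
  then obtain \<sigma> where \<sigma>: "\<sigma> \<in> {-1, 1}" "\<And>x. t \<le> x \<Longrightarrow> x \<le> b \<Longrightarrow> 0 \<le> \<sigma> * f x"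
    by (metis atLeastAtMost_iff)
  have fJ: "finite J" "t \<notin> J" using J(1) insert.hyps finite_subset by auto
  have pos: "0 \<le> (\<Prod>t\<in>J. x - t)" if "t \<le> x" for x
    using J(1) insert.hyps(2) that by (intro prod_nonneg) force
  show ?case
  proof (cases "\<sigma> = s")
    case True
    have "0 \<le> s * f x * (\<Prod>t\<in>J. x - t)" if "x \<in> {a..b}" for x
      using J(3)[of x] \<sigma>(2)[of x] pos[of x] that True by (cases "x \<le> t") auto
    then show ?thesis using J(1,2) by blast
  next
    case False
    have "0 \<le> (- s) * f x * (\<Prod>t\<in>insert t J. x - t)" if "x \<in> {a..b}" for x
    proof (cases "x \<le> t")
      case True
      have "0 \<le> (s * f x * (\<Prod>t\<in>J. x - t)) * (t - x)" using J(3)[of x] True that by simp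
      then show ?thesis using fJ by (simp add: algebra_simps)
    next
      case False
      have "\<sigma> = - s" using \<open>\<sigma> \<noteq> s\<close> \<sigma>(1) J(2) by auto
      moreover have "0 \<le> (\<sigma> * f x) * ((x - t) * (\<Prod>t\<in>J. x - t))"
        using False that by (intro mult_nonneg_nonneg[OF \<sigma>(2) mult_nonneg_nonneg[OF _ pos]]) auto
      ultimately show ?thesis using fJ by (simp add: mult.assoc)
    qed
    moreover have "insert t J \<subseteq> insert t Z" "- s \<in> {-1, 1}" using J by auto
    ultimately show ?thesis by blast
  qed
qed

text \<open>For \<open>x\<close> and \<open>t\<close> in \<open>[0, 2 * pi]\<close> the half
  difference lies between \<open>- pi\<close> and \<open>pi\<close>, so its sine agrees in sign with
  \<open>x - t\<close> and can replace the linear factor. An even number of factors gives the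
  product an integer central frequency.\<close>

lemma exists_sine_multiplier:
  assumes f: "continuous_on {0..2*pi} f" and K: "at_most_roots K f {0..2*pi}"
  shows "\<exists>ts. length ts = 2 * K \<and>
    (\<exists>s\<in>{-1, 1}. \<forall>\<theta>\<in>{0..2*pi}. 0 \<le> s * f \<theta> * (\<Prod>t\<leftarrow>ts. 2 * sin ((\<theta> - t) / 2)))"
proof -
  define Z where "Z = {\<theta> \<in> {0..2*pi}. f \<theta> = 0}"
  have Z: "finite Z" "card Z \<le> K" using K by (auto simp: at_most_roots_def Z_def)
  have "\<exists>J\<subseteq>Z. \<exists>s\<in>{-1, 1}. \<forall>x\<in>{0..2*pi}. 0 \<le> s * f x * (\<Prod>t\<in>J. x - t)"
    using Z f by (intro sign_pattern) (auto simp: Z_def)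
  then obtain J s where J: "J \<subseteq> Z" "s \<in> {-1, 1}" "\<And>x. x \<in> {0..2*pi} \<Longrightarrow> 0 \<le> s * f x * (\<Prod>t\<in>J. x - t)"
    by blast
  have finJ: "finite J" using J(1) Z finite_subset by blast
  have cardJ: "card J \<le> K" using card_mono[OF Z(1) J(1)] Z(2) by simp
  \<comment> \<open>Padding with \<open>t = 0\<close> is harmless, since \<open>sin (x / 2) \<ge> 0\<close> on \<open>[0, 2\<pi>]\<close>, and makes the degree even.\<close>
  define ts where "ts = sorted_list_of_set J @ replicate (2 * K - card J) 0"
  have "0 \<le> s * f x * (\<Prod>t\<leftarrow>ts. 2 * sin ((x - t) / 2))" if x: "x \<in> {0..2*pi}" for x
  proof -
    define Q where "Q = (\<Prod>t\<in>J. x - t)"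
    define Q' where "Q' = (\<Prod>t\<in>J. 2 * sin ((x - t) / 2))"
    have "0 \<le> (x - t) * (2 * sin ((x - t) / 2))" if "t \<in> J" for t
    proof (cases "t \<le> x")
      case True
      then have "0 \<le> sin ((x - t) / 2)" using that J(1) x by (intro sin_ge_zero) (auto simp: Z_def)
      then show ?thesis using True by simp
    next
      case False
      then have "0 \<le> sin ((t - x) / 2)" using that J(1) x by (intro sin_ge_zero) (auto simp: Z_def)
      moreover have "sin ((x - t) / 2) = - sin ((t - x) / 2)"
        unfolding sin_minus[symmetric] by (rule arg_cong[where f = sin]) (simp add: field_simps)
      ultimately show ?thesis using False by (intro mult_nonpos_nonpos) auto
    qed
    then have QQ: "0 \<le> Q * Q'" unfolding Q_def Q'_def prod.distrib[symmetric] by (intro prod_nonneg) auto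
    \<comment> \<open>The sign passes from \<open>Q\<close> to \<open>Q'\<close> by cancelling
      \<open>Q\<^sup>2\<close>; where \<open>Q\<close> vanishes, so does \<open>Q'\<close>.\<close>
    have "0 \<le> s * f x * Q'"
    proof (cases "Q = 0")
      case True
      then obtain t where "t \<in> J" "x = t" using finJ by (auto simp: Q_def)
      then have "Q' = 0" using finJ unfolding Q'_def by (intro prod_zero bexI[of _ t]) auto
      then show ?thesis by simp
    next
      case False
      have "0 \<le> (s * f x * Q) * (Q * Q')" using J(3)[OF x] QQ by (simp add: Q_def)
      also have "\<dots> = (s * f x * Q') * Q\<^sup>2" by (simp add: power2_eq_square)
      finally show ?thesis using False by (simp add: zero_le_mult_iff)
    qed
    moreover have "0 \<le> 2 * sin (x / 2)" using x by (auto intro!: sin_ge_zero)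
    moreover have "(\<Prod>t\<leftarrow>ts. 2 * sin ((x - t) / 2)) = Q' * (2 * sin (x / 2)) ^ (2 * K - card J)"
      using finJ by (simp add: ts_def Q'_def prod.distinct_set_conv_list[symmetric] prod_list_replicate map_replicate)
    ultimately show ?thesis by (simp add: mult.assoc[symmetric])
  qed
  moreover have "length ts = 2 * K" using cardJ finJ by (simp add: ts_def)
  ultimately show ?thesis using J(2) by blast
qed

section \<open>Polynomials with all roots on the unit circle\<close>

definition unit_poly :: "real list \<Rightarrow> complex poly" where
  "unit_poly ts = (\<Prod>t\<leftarrow>ts. [:- cis t, 1:])"

lemma degree_unit_poly: "degree (unit_poly ts) \<le> length ts"
proof (induction ts)
  case (Cons t ts)
  then show ?case using degree_mult_le[of "[:- cis t, 1:]" "unit_poly ts"] by (simp add: unit_poly_def)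
qed (simp add: unit_poly_def)

text \<open>A factor \<open>z - cis t\<close> at most doubles the largest coefficient. The bound is
  uniform in the roots, which depend on the trigonometric polynomial.\<close>

lemma norm_coeff_unit_poly: "norm (coeff (unit_poly ts) i) \<le> 2 ^ length ts"
proof (induction ts arbitrary: i)
  case (Cons t ts)
  have "coeff (unit_poly (t # ts)) i = - cis t * coeff (unit_poly ts) i + (case i of 0 \<Rightarrow> 0 | Suc j \<Rightarrow> coeff (unit_poly ts) j)"
    by (simp add: unit_poly_def coeff_pCons split: nat.splits)
  also have "norm \<dots> \<le> 2 ^ length ts + 2 ^ length ts"
    using Cons.IH by (intro norm_triangle_mono) (auto simp: norm_mult split: nat.splits)
  finally show ?case by simp
qed (simp add: unit_poly_def coeff_pCons split: nat.splits)

text \<open>Up to sign this is the product of the roots. It is the coefficient of the newest term in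
  the recurrence, which can thus be solved for that term without loss.\<close>

lemma norm_coeff_0_unit_poly: "norm (coeff (unit_poly ts) 0) = 1"
  by (induction ts) (auto simp: unit_poly_def norm_mult coeff_mult_0)

text \<open>Each factor is \<open>cis \<theta> - cis t = \<i> * cis ((\<theta> + t) / 2) * 2 * sin
  ((\<theta> - t) / 2)\<close>.\<close>

lemma poly_unit_poly_cis:
  "\<exists>w. norm w = 1 \<and> (\<forall>\<theta>. poly (unit_poly ts) (cis \<theta>) =
     w * cis (of_nat (length ts) * \<theta> / 2) * of_real (\<Prod>t\<leftarrow>ts. 2 * sin ((\<theta> - t) / 2)))"
proof (induction ts)
  case Nil
  show ?case by (rule exI[of _ 1]) (simp add: unit_poly_def)
next
  case (Cons t ts)
  then obtain w where w: "norm w = 1" "\<And>\<theta>. poly (unit_poly ts) (cis \<theta>) =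
     w * cis (of_nat (length ts) * \<theta> / 2) * of_real (\<Prod>t\<leftarrow>ts. 2 * sin ((\<theta> - t) / 2))" by blast
  have "poly (unit_poly (t # ts)) (cis \<theta>) = (\<i> * cis (t / 2) * w) * cis (of_nat (length (t # ts)) * \<theta> / 2)
          * of_real (\<Prod>t\<leftarrow>t # ts. 2 * sin ((\<theta> - t) / 2))" for \<theta>
  proof -
    have "cis \<theta> - cis t = cis ((\<theta> + t) / 2) * (cis ((\<theta> - t) / 2) - cis (- ((\<theta> - t) / 2)))"
      unfolding right_diff_distrib cis_mult by (simp add: field_simps)
    also have "cis ((\<theta> - t) / 2) - cis (- ((\<theta> - t) / 2)) = \<i> * of_real (2 * sin ((\<theta> - t) / 2))"
      by (simp add: complex_eq_iff)
    finally have eq: "cis \<theta> - cis t = cis ((\<theta> + t) / 2) * (\<i> * of_real (2 * sin ((\<theta> - t) / 2)))" .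
    have "poly (unit_poly (t # ts)) (cis \<theta>) = cis ((\<theta> + t) / 2) * (\<i> * of_real (2 * sin ((\<theta> - t) / 2))) * poly (unit_poly ts) (cis \<theta>)"
      unfolding eq[symmetric] by (simp add: unit_poly_def algebra_simps)
    moreover have "cis ((\<theta> + t) / 2) * cis (of_nat (length ts) * \<theta> / 2) = cis (t / 2) * cis (of_nat (length (t # ts)) * \<theta> / 2)"
      unfolding cis_mult by (rule arg_cong[where f = cis]) (simp add: field_simps)
    ultimately show ?thesis by (simp add: w(2))
  qed
  then show ?case using w(1) by (intro exI[of _ "\<i> * cis (t / 2) * w"]) (simp add: norm_mult)
qed

text \<open>Up to a unimodular constant, \<open>h \<theta>\<close> is
  \<open>cis (K * \<theta>)\<close> times a real function of constant sign. Removing this frequency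
  leaves a constant phase, so the modulus may be taken outside the integral.\<close>

lemma integral_norm_multiplier:
  fixes f :: "real \<Rightarrow> real"
  assumes len: "length ts = 2 * K" and s: "s \<in> {-1, 1}" and f: "continuous_on {0..2*pi} f"
    and sign: "\<And>\<theta>. \<theta> \<in> {0..2*pi} \<Longrightarrow> 0 \<le> s * f \<theta> * (\<Prod>t\<leftarrow>ts. 2 * sin ((\<theta> - t) / 2))"
    and h: "\<And>\<theta>. h \<theta> = of_real (f \<theta>) * poly (unit_poly ts) (cis \<theta>)"
  shows "integral {0..2*pi} (\<lambda>\<theta>. norm (h \<theta>)) = norm (fourier_coeff h (int K))"
proof -
  obtain w where w: "norm w = 1" "\<And>\<theta>. poly (unit_poly ts) (cis \<theta>) =
     w * cis (of_nat (length ts) * \<theta> / 2) * of_real (\<Prod>t\<leftarrow>ts. 2 * sin ((\<theta> - t) / 2))"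
    using poly_unit_poly_cis by blast
  have hc: "continuous_on {0..2*pi} h" unfolding h[abs_def] by (intro continuous_intros f)
  have eq: "complex_of_real (norm (h \<theta>)) = (of_real s * cnj w) * (h \<theta> * cis (- (of_int (int K) * \<theta>)))"
    if \<theta>: "\<theta> \<in> {0..2*pi}" for \<theta>
  proof -
    define g where "g = f \<theta> * (\<Prod>t\<leftarrow>ts. 2 * sin ((\<theta> - t) / 2))"
    have hg: "h \<theta> = w * cis (of_nat K * \<theta>) * of_real g"
      using len by (simp add: h w(2) g_def)
    have "norm (h \<theta>) = \<bar>g\<bar>" by (simp add: hg norm_mult w(1))
    also have "\<dots> = s * g" using sign[OF \<theta>] s by (auto simp: g_def mult.assoc)
    finally have "complex_of_real (norm (h \<theta>)) = of_real s * of_real g" by simp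
    also have "\<dots> = of_real s * ((cnj w * w) * (cis (of_nat K * \<theta>) * cis (- (of_nat K * \<theta>))) * of_real g)"
      using complex_norm_square[of w] w(1) by (simp add: cis_mult mult.commute)
    also have "\<dots> = (of_real s * cnj w) * (h \<theta> * cis (- (of_int (int K) * \<theta>)))" by (simp add: hg mult_ac)
    finally show ?thesis .
  qed
  have "complex_of_real (integral {0..2*pi} (\<lambda>\<theta>. norm (h \<theta>))) = integral {0..2*pi} (\<lambda>\<theta>. complex_of_real (norm (h \<theta>)))"
    by (intro integral_unique[symmetric] has_integral_of_real integrable_integral
        integrable_continuous_interval continuous_intros hc)
  also have "\<dots> = integral {0..2*pi} (\<lambda>\<theta>. (of_real s * cnj w) * (h \<theta> * cis (- (of_int (int K) * \<theta>))))"
    by (rule integral_cong) (rule eq)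
  also have "\<dots> = (of_real s * cnj w) * fourier_coeff h (int K)" by (simp only: fourier_coeff_def integral_mult_right)
  finally have "norm (complex_of_real (integral {0..2*pi} (\<lambda>\<theta>. norm (h \<theta>)))) = norm ((of_real s * cnj w) * fourier_coeff h (int K))"
    by (rule arg_cong)
  moreover have "0 \<le> integral {0..2*pi} (\<lambda>\<theta>. norm (h \<theta>))"
    by (intro integral_nonneg integrable_continuous_interval continuous_intros hc) auto
  ultimately show ?thesis using s w(1) by (auto simp: norm_mult)
qed

section \<open>Fourier coefficients as a recurrence in the original coefficients\<close>

text \<open>Orthogonality of the exponentials retains the terms with \<open>s = r - int j\<close>:
  the coefficient at \<open>r\<close> depends on the window of \<open>c\<close> from
  \<open>r - D\<close> to \<open>r\<close> only.\<close>

lemma fourier_coeff_convolution: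
  assumes "finite X" "\<And>s. s \<notin> X \<Longrightarrow> c s = 0" "degree P \<le> D"
  shows "fourier_coeff (\<lambda>\<theta>. (\<Sum>s\<in>X. c s * cis (of_int s * \<theta>)) * poly P (cis \<theta>)) r =
     2 * of_real pi * (\<Sum>j\<le>D. coeff P j * c (r - int j))"
proof -
  have P: "poly P z = (\<Sum>j\<le>D. coeff P j * z ^ j)" for z
    unfolding poly_altdef using assms(3) by (intro sum.mono_neutral_left) (auto simp: coeff_eq_0)
  have "fourier_coeff (\<lambda>\<theta>. (\<Sum>s\<in>X. c s * cis (of_int s * \<theta>)) * poly P (cis \<theta>)) r
    = integral {0..2*pi} (\<lambda>\<theta>. \<Sum>j\<le>D. \<Sum>s\<in>X. (coeff P j * c s) * cis (of_int (s + int j - r) * \<theta>))"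
    unfolding fourier_coeff_def
  proof (rule integral_cong)
    fix \<theta> :: real
    have "cis (of_int s * \<theta>) * cis \<theta> ^ j * cis (- (of_int r * \<theta>)) = cis (of_int (s + int j - r) * \<theta>)" for s j
      unfolding Complex.DeMoivre cis_mult by (rule arg_cong[where f = cis]) (simp add: algebra_simps)
    then have "(coeff P j * c s) * cis (of_int (s + int j - r) * \<theta>) = c s * cis (of_int s * \<theta>) * (coeff P j * cis \<theta> ^ j) * cis (- (of_int r * \<theta>))" for s j
      by (metis (no_types, opaque_lifting) mult.assoc mult.commute mult.left_commute)
    then show "(\<Sum>s\<in>X. c s * cis (of_int s * \<theta>)) * poly P (cis \<theta>) * cis (- (of_int r * \<theta>))
      = (\<Sum>j\<le>D. \<Sum>s\<in>X. (coeff P j * c s) * cis (of_int (s + int j - r) * \<theta>))"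
      by (simp only: P sum_distrib_left sum_distrib_right)
  qed
  also have "\<dots> = (\<Sum>j\<le>D. \<Sum>s\<in>X. integral {0..2*pi} (\<lambda>\<theta>. (coeff P j * c s) * cis (of_int (s + int j - r) * \<theta>)))"
    using assms(1) by (subst integral_sum; (intro sum.cong refl integral_sum)?)
      (auto intro!: integrable_continuous_interval continuous_intros)
  also have "\<dots> = (\<Sum>j\<le>D. \<Sum>s\<in>X. if s = r - int j then (coeff P j * c s) * (2 * of_real pi) else 0)"
    by (intro sum.cong refl) (auto simp: integral_mult_right integral_cis simp del: of_int_add of_int_diff)
  also have "\<dots> = (\<Sum>j\<le>D. coeff P j * c (r - int j) * (2 * of_real pi))"
    using assms(1,2) by (intro sum.cong refl) (auto simp: sum.delta)
  finally show ?thesis by (simp add: sum_distrib_left mult_ac)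
qed

text \<open>The coefficients of twice the trigonometric polynomial; the doubling makes them Gaussian
  integers.\<close>

definition trig_coeff :: "(int \<Rightarrow> int) \<Rightarrow> (int \<Rightarrow> int) \<Rightarrow> nat \<Rightarrow> int \<Rightarrow> complex" where
  "trig_coeff A B n r =
     (if r \<in> {1..int n} then Complex (A r) (- B r)
      else if - r \<in> {1..int n} then Complex (A (- r)) (B (- r)) else 0)"

lemma trig_poly_exponential:
  "complex_of_real (2 * trig_poly A B n \<theta>) =
    (\<Sum>r\<in>{1..int n} \<union> uminus ` {1..int n}. trig_coeff A B n r * cis (of_int r * \<theta>))"
proof -
  have "(\<Sum>r\<in>{1..int n} \<union> uminus ` {1..int n}. trig_coeff A B n r * cis (of_int r * \<theta>)) =
     (\<Sum>r\<in>{1..int n}. trig_coeff A B n r * cis (of_int r * \<theta>)) + (\<Sum>r\<in>{1..int n}. trig_coeff A B n (- r) * cis (of_int (- r) * \<theta>))"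
    by (subst sum.union_disjoint, auto simp del: image_uminus_atLeastAtMost simp: sum.reindex)
  also have "\<dots> = (\<Sum>r\<in>{1..int n}. complex_of_real (2 * (A r * cos (r * \<theta>) + B r * sin (r * \<theta>))))"
    unfolding sum.distrib[symmetric]
    by (intro sum.cong refl) (auto simp: trig_coeff_def complex_eq_iff algebra_simps)
  finally show ?thesis
    by (simp add: trig_poly_def sum.distrib sum_distrib_left)
qed

subsection \<open>Partitions into periodic intervals\<close>

text \<open>The intervals may be empty, so \<open>L\<close> can be raised freely once
  \<open>1 \<le> C\<close>.\<close>

definition periodic_split :: "(int \<Rightarrow> 'a) \<Rightarrow> (int \<Rightarrow> 'b) \<Rightarrow> nat \<Rightarrow> int \<Rightarrow> int \<Rightarrow> nat \<Rightarrow> bool" where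
  "periodic_split A B C s e L \<longleftrightarrow> (\<exists>I. (\<forall>i\<in>{1..L}. int_interval (I i)) \<and>
     disjoint_family_on I {1..L} \<and> (\<Union>i\<in>{1..L}. I i) = {s..e} \<and>
     (\<forall>i\<in>{1..L}. (\<exists>p\<le>C. periodic_on (I i) A p) \<and> (\<exists>q\<le>C. periodic_on (I i) B q)))"

lemma periodic_split_single:
  "periodic_on {s..e} A p \<Longrightarrow> periodic_on {s..e} B q \<Longrightarrow> p \<le> C \<Longrightarrow> q \<le> C \<Longrightarrow> periodic_split A B C s e 1"
  unfolding periodic_split_def
  by (rule exI[of _ "\<lambda>_. {s..e}"]) (auto simp: int_interval_def disjoint_family_on_def)

lemma periodic_split_empty: "e < s \<Longrightarrow> periodic_split A B C s e 0"
  unfolding periodic_split_def by (auto simp: disjoint_family_on_def)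

lemma periodic_split_append:
  assumes "periodic_split A B C s m L" "periodic_split A B C (m + 1) e L'" "s \<le> m + 1" "m \<le> e"
  shows "periodic_split A B C s e (L + L')"
proof -
  obtain I where I: "\<And>i. i \<in> {1..L} \<Longrightarrow> int_interval (I i)" "disjoint_family_on I {1..L}"
     "(\<Union>i\<in>{1..L}. I i) = {s..m}"
     "\<And>i. i \<in> {1..L} \<Longrightarrow> (\<exists>p\<le>C. periodic_on (I i) A p) \<and> (\<exists>q\<le>C. periodic_on (I i) B q)"
    using assms(1) unfolding periodic_split_def by blast
  obtain J where J: "\<And>i. i \<in> {1..L'} \<Longrightarrow> int_interval (J i)" "disjoint_family_on J {1..L'}"
     "(\<Union>i\<in>{1..L'}. J i) = {m+1..e}"
     "\<And>i. i \<in> {1..L'} \<Longrightarrow> (\<exists>p\<le>C. periodic_on (J i) A p) \<and> (\<exists>q\<le>C. periodic_on (J i) B q)"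
    using assms(2) unfolding periodic_split_def by blast
  define H where "H i = (if i \<le> L then I i else J (i - L))" for i
  have idx: "(i \<in> {1..L} \<and> H i = I i) \<or> (i - L \<in> {1..L'} \<and> L < i \<and> H i = J (i - L))" if "i \<in> {1..L + L'}" for i
    using that by (auto simp: H_def)
  have HI: "H i = I i" if "i \<in> {1..L}" for i using that by (auto simp: H_def)
  have HJ: "H (i + L) = J i" if "i \<in> {1..L'}" for i using that by (auto simp: H_def)
  have IJ: "I i \<inter> J j = {}" if "i \<in> {1..L}" "j \<in> {1..L'}" for i j
  proof -
    have "I i \<subseteq> {s..m}" "J j \<subseteq> {m+1..e}" using that I(3) J(3) by blast+
    then show ?thesis by fastforce
  qed
  have "disjoint_family_on H {1..L + L'}"
    unfolding disjoint_family_on_def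
  proof (intro ballI impI)
    fix i j assume ij: "i \<in> {1..L + L'}" "j \<in> {1..L + L'}" "i \<noteq> j"
    consider "i \<in> {1..L}" "j \<in> {1..L}" | "i \<in> {1..L}" "j - L \<in> {1..L'}" "L < j"
      | "i - L \<in> {1..L'}" "L < i" "j \<in> {1..L}" | "i - L \<in> {1..L'}" "j - L \<in> {1..L'}" "L < i" "L < j"
      using ij(1,2) by fastforce
    then show "H i \<inter> H j = {}"
    proof cases
      case 1
      then show ?thesis using disjoint_family_onD[OF I(2) _ _ ij(3)] by (simp add: H_def)
    next
      case 2
      then show ?thesis using IJ[OF 2(1,2)] by (simp add: H_def)
    next
      case 3
      then show ?thesis using IJ[OF 3(3,1)] by (simp add: H_def Int_commute)
    next
      case 4
      then have "i - L \<noteq> j - L" using ij(3) by linarith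
      then show ?thesis using disjoint_family_onD[OF J(2) 4(1,2)] 4 by (simp add: H_def)
    qed
  qed
  moreover have "(\<Union>i\<in>{1..L + L'}. H i) = {s..e}"
  proof (intro equalityI subsetI)
    fix x assume "x \<in> (\<Union>i\<in>{1..L + L'}. H i)"
    then obtain i where i: "i \<in> {1..L + L'}" "x \<in> H i" by blast
    from idx[OF i(1)] have "x \<in> {s..m} \<union> {m+1..e}" using i(2) I(3) J(3) by blast
    then show "x \<in> {s..e}" using assms(3,4) by auto
  next
    fix x assume x: "x \<in> {s..e}"
    show "x \<in> (\<Union>i\<in>{1..L + L'}. H i)"
    proof (cases "x \<le> m")
      case True
      then have "x \<in> (\<Union>i\<in>{1..L}. I i)" using x I(3) by simp
      then obtain i where "i \<in> {1..L}" "x \<in> I i" by blast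
      then show ?thesis using HI by (intro UN_I[of i]) auto
    next
      case False
      then have "x \<in> (\<Union>i\<in>{1..L'}. J i)" using x J(3) by simp
      then obtain i where "i \<in> {1..L'}" "x \<in> J i" by blast
      then show ?thesis using HJ by (intro UN_I[of "i + L"]) auto
    qed
  qed
  moreover have "\<forall>i\<in>{1..L + L'}. int_interval (H i)" using idx I(1) J(1) by metis
  moreover have "\<forall>i\<in>{1..L + L'}. (\<exists>p\<le>C. periodic_on (H i) A p) \<and> (\<exists>q\<le>C. periodic_on (H i) B q)"
    using idx I(4) J(4) by metis
  ultimately show ?thesis unfolding periodic_split_def by blast
qed

lemma periodic_split_mono:
  assumes "periodic_split A B C s e L" "L \<le> L'" "1 \<le> C"
  shows "periodic_split A B C s e L'"
proof -
  obtain I where I: "\<And>i. i \<in> {1..L} \<Longrightarrow> int_interval (I i)" "disjoint_family_on I {1..L}"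
     "(\<Union>i\<in>{1..L}. I i) = {s..e}"
     "\<And>i. i \<in> {1..L} \<Longrightarrow> (\<exists>p\<le>C. periodic_on (I i) A p) \<and> (\<exists>q\<le>C. periodic_on (I i) B q)"
    using assms(1) unfolding periodic_split_def by blast
  have triv: "\<exists>p\<le>C. periodic_on {} A p" "\<exists>q\<le>C. periodic_on {} B q"
    using assms(3) by (auto simp: periodic_on_def)
  show ?thesis unfolding periodic_split_def
  proof (rule exI[of _ "\<lambda>i. if i \<le> L then I i else {}"], intro conjI ballI)
    fix i assume "i \<in> {1..L'}"
    show "int_interval (if i \<le> L then I i else {})" "\<exists>p\<le>C. periodic_on (if i \<le> L then I i else {}) A p"
      "\<exists>q\<le>C. periodic_on (if i \<le> L then I i else {}) B q"
      using I(1)[of i] I(4)[of i] triv \<open>i \<in> {1..L'}\<close> by (simp_all add: int_interval_def)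
  next
    show "disjoint_family_on (\<lambda>i. if i \<le> L then I i else {}) {1..L'}"
      using I(2) by (auto simp: disjoint_family_on_def)
    show "(\<Union>i\<in>{1..L'}. if i \<le> L then I i else {}) = {s..e}"
      using assms(2) unfolding I(3)[symmetric] by (fastforce split: if_splits)
  qed
qed

lemma periodic_split_points:
  assumes "1 \<le> C" "e - s + 1 \<le> int m"
  shows "periodic_split A B C s e m"
  using assms(2)
proof (induction m arbitrary: e)
  case 0
  then show ?case by (intro periodic_split_empty) auto
next
  case (Suc m)
  show ?case
  proof (cases "e < s")
    case True
    then show ?thesis using periodic_split_mono[OF periodic_split_empty[OF True] _ assms(1)] by simp
  next
    case False
    have "periodic_split A B C e e 1"
      using assms(1) by (intro periodic_split_single[of _ _ _ 1 _ 1]) (auto simp: periodic_on_def)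
    then have "periodic_split A B C s e (m + 1)"
      using Suc False by (intro periodic_split_append[of A B C s "e - 1" m e 1]) auto
    then show ?thesis by simp
  qed
qed

text \<open>Among \<open>N + 1\<close> successive positions two have the same \<open>D\<close>
  predecessors, and from the first of them on the sequence is periodic, with period at most
  \<open>N\<close>. The at most \<open>N\<close> earlier terms become singletons. Windows may reach
  below \<open>s\<close>.\<close>

lemma periodic_split_deterministic:
  fixes c :: "int \<Rightarrow> 'a" and D N :: nat
  assumes V: "finite V" "\<And>r. c r \<in> V" and N: "card (PiE {1..D} (\<lambda>_. V)) \<le> N" "N \<le> C" "1 \<le> C"
    and det: "\<And>x y. x \<in> {s..e} \<Longrightarrow> y \<in> {s..e} \<Longrightarrow> (\<And>j. j \<in> {1..D} \<Longrightarrow> c (x - int j) = c (y - int j)) \<Longrightarrow> c x = c y"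
    and AB: "\<And>x y. x \<in> {s..e} \<Longrightarrow> y \<in> {s..e} \<Longrightarrow> c x = c y \<Longrightarrow> A x = A y \<and> B x = B y"
  shows "periodic_split A B C s e (N + 1)"
proof (cases "e - s + 1 \<le> int N")
  case True
  then show ?thesis by (intro periodic_split_points N) auto
next
  case False
  define st where "st x = restrict (\<lambda>j. c (x - int j)) {1..D}" for x
  have "st ` {s..s + int N} \<subseteq> PiE {1..D} (\<lambda>_. V)" using V(2) by (auto simp: st_def)
  then have "card (st ` {s..s + int N}) \<le> N"
    using N(1) V(1) card_mono[OF finite_PiE] by (meson finite_atLeastAtMost order_trans)
  then have "\<not> inj_on st {s..s + int N}" by (intro notI) (simp add: card_image)
  then obtain x0 y0 where "x0 \<in> {s..s + int N}" "y0 \<in> {s..s + int N}" "st x0 = st y0" "x0 \<noteq> y0"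
    by (auto simp: inj_on_def)
  then obtain x y where xy: "s \<le> x" "x < y" "y \<le> s + int N" "st x = st y"
    by (metis atLeastAtMost_iff linorder_neq_iff)
  have st0: "c (x - int j) = c (y - int j)" if "j \<in> {1..D}" for j
    using fun_cong[OF xy(4), of j] that by (simp add: st_def)
  \<comment> \<open>Predecessors at distance \<open>j \<le> i\<close> agree by induction, the older
    ones by equality of the states at \<open>x\<close> and \<open>y\<close>.\<close>
  have shift: "c (x + int i) = c (y + int i)" if "y + int i \<le> e" for i
    using that
  proof (induction i rule: less_induct)
    case (less i)
    show ?case
    proof (rule det)
      fix j assume j: "j \<in> {1..D}"
      show "c (x + int i - int j) = c (y + int i - int j)"
      proof (cases "j \<le> i")
        case True
        then show ?thesis using less.IH[of "i - j"] less.prems j by (simp add: of_nat_diff algebra_simps)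
      next
        case False
        then have "j - i \<in> {1..D}" using j by auto
        from st0[OF this] show ?thesis using False by (simp add: of_nat_diff algebra_simps)
      qed
    qed (use xy less.prems in auto)
  qed
  have per: "c r = c (r + int (nat (y - x)))" if "r \<in> {x..e}" "r + int (nat (y - x)) \<in> {x..e}" for r
    using shift[of "nat (r - x)"] that xy by (simp add: algebra_simps)
  have "periodic_split A B C x e 1"
  proof (rule periodic_split_single)
    show "periodic_on {x..e} A (nat (y - x))" "periodic_on {x..e} B (nat (y - x))"
      unfolding periodic_on_def using per AB xy by auto
  qed (use xy N in auto)
  moreover have "periodic_split A B C s (x - 1) N" using xy by (intro periodic_split_points N) auto
  ultimately show ?thesis
    using xy False by (intro periodic_split_append[of A B C s "x - 1" N e 1]) auto
qed

text \<open>Cut at the least exceptional index: the stretch before it takes \<open>N + 1\<close>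
  intervals and the index itself one, so each exception costs \<open>N + 2\<close>.\<close>

lemma periodic_split_exceptional:
  fixes c :: "int \<Rightarrow> 'a" and D N :: nat
  assumes V: "finite V" "\<And>r. c r \<in> V" and N: "card (PiE {1..D} (\<lambda>_. V)) \<le> N" "N \<le> C" "1 \<le> C"
    and "\<And>x y. x \<in> {s..e} - \<Lambda> \<Longrightarrow> y \<in> {s..e} - \<Lambda> \<Longrightarrow> (\<And>j. j \<in> {1..D} \<Longrightarrow> c (x - int j) = c (y - int j)) \<Longrightarrow> c x = c y"
    and "\<And>x y. x \<in> {s..e} \<Longrightarrow> y \<in> {s..e} \<Longrightarrow> c x = c y \<Longrightarrow> A x = A y \<and> B x = B y"
    and "card (\<Lambda> \<inter> {s..e}) \<le> m"
  shows "periodic_split A B C s e (N + 1 + m * (N + 2))"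
  using assms(6-8)
proof (induction m arbitrary: s)
  case 0
  then have "\<Lambda> \<inter> {s..e} = {}" by simp
  then have *: "{s..e} - \<Lambda> = {s..e}" by blast
  have "periodic_split A B C s e (N + 1)"
    by (rule periodic_split_deterministic[OF V N 0(1)[unfolded *] 0(2)])
  then show ?case by simp
next
  case (Suc m)
  show ?case
  proof (cases "\<Lambda> \<inter> {s..e} = {}")
    case True
    then have *: "{s..e} - \<Lambda> = {s..e}" by blast
    have "periodic_split A B C s e (N + 1)"
      by (rule periodic_split_deterministic[OF V N Suc.prems(1)[unfolded *] Suc.prems(2)])
    then show ?thesis by (rule periodic_split_mono[OF _ _ N(3)]) simp
  next
    case False
    define l where "l = Min (\<Lambda> \<inter> {s..e})"
    have l: "l \<in> \<Lambda> \<inter> {s..e}" unfolding l_def using False by (intro Min_in) auto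
    have lmin: "{s..l - 1} \<inter> \<Lambda> = {}"
    proof (rule ccontr)
      assume "{s..l - 1} \<inter> \<Lambda> \<noteq> {}"
      then obtain z where "z \<in> \<Lambda>" "s \<le> z" "z < l" by auto
      moreover have "z \<in> \<Lambda> \<inter> {s..e}" using calculation l by auto
      then have "l \<le> z" unfolding l_def by (intro Min_le) auto
      ultimately show False by simp
    qed
    have 1: "periodic_split A B C s (l - 1) (N + 1)"
    proof (rule periodic_split_deterministic[OF V N])
      show "c x = c y" if "x \<in> {s..l - 1}" "y \<in> {s..l - 1}" "\<And>j. j \<in> {1..D} \<Longrightarrow> c (x - int j) = c (y - int j)" for x y
      proof (rule Suc.prems(1)[OF _ _ that(3)])
        show "x \<in> {s..e} - \<Lambda>" "y \<in> {s..e} - \<Lambda>" using that(1,2) lmin l by auto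
      qed
      show "A x = A y \<and> B x = B y" if "x \<in> {s..l - 1}" "y \<in> {s..l - 1}" "c x = c y" for x y
        using Suc.prems(2)[of x y] that l by auto
    qed
    have 2: "periodic_split A B C l l 1" using N(3) by (intro periodic_split_points) auto
    have 3: "periodic_split A B C (l + 1) e (N + 1 + m * (N + 2))"
    proof (rule Suc.IH)
      show "c x = c y" if "x \<in> {l + 1..e} - \<Lambda>" "y \<in> {l + 1..e} - \<Lambda>" "\<And>j. j \<in> {1..D} \<Longrightarrow> c (x - int j) = c (y - int j)" for x y
        using Suc.prems(1)[of x y] that l by auto
      show "A x = A y \<and> B x = B y" if "x \<in> {l + 1..e}" "y \<in> {l + 1..e}" "c x = c y" for x y
        using Suc.prems(2)[of x y] that l by auto
      have "\<Lambda> \<inter> {l + 1..e} \<subset> \<Lambda> \<inter> {s..e}"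
      proof (rule psubsetI)
        show "\<Lambda> \<inter> {l + 1..e} \<subseteq> \<Lambda> \<inter> {s..e}" using l by auto
        have "l \<notin> \<Lambda> \<inter> {l + 1..e}" by simp
        then show "\<Lambda> \<inter> {l + 1..e} \<noteq> \<Lambda> \<inter> {s..e}" using l by metis
      qed
      then have "card (\<Lambda> \<inter> {l + 1..e}) < card (\<Lambda> \<inter> {s..e})" by (intro psubset_card_mono) auto
      then show "card (\<Lambda> \<inter> {l + 1..e}) \<le> m" using Suc.prems(3) by simp
    qed
    have "periodic_split A B C s l (N + 1 + 1)"
      using l 2 by (intro periodic_split_append[OF 1]) auto
    from periodic_split_append[OF this 3] l
    show ?thesis by (simp add: algebra_simps)
  qed
qed

section \<open>Choice of a scale with a spectral gap, and the resulting partition\<close>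

theorem theorem4:
  fixes R :: "int set" and K :: nat
  assumes "finite R" and "K \<ge> 1"
  shows "\<exists>C::nat. C \<ge> 1 \<and>
    (\<forall>(n::nat) (A::int \<Rightarrow> int) (B::int \<Rightarrow> int).
       n \<ge> 1 \<longrightarrow>
       (\<forall>r\<in>{1..int n}. A r \<in> R \<and> B r \<in> R) \<longrightarrow>
       at_most_roots K (trig_poly A B n) {0..2 * pi} \<longrightarrow>
       (\<exists>(L::nat) (I :: nat \<Rightarrow> int set).
          L < C \<and>
          (\<forall>i\<in>{1..L}. int_interval (I i)) \<and>
          disjoint_family_on I {1..L} \<and>
          (\<Union>i\<in>{1..L}. I i) = {1..int n} \<and>
          (\<forall>i\<in>{1..L}.
             (\<exists>p\<le>C. periodic_on (I i) A p) \<and>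
             (\<exists>q\<le>C. periodic_on (I i) B q))))"
proof -
  define D where "D = 2 * K"
  \<comment> \<open>Contains every Fourier coefficient of twice the polynomial; \<open>- R\<close>
    serves the imaginary parts \<open>- B r\<close>.\<close>
  define V where "V = insert 0 ((\<lambda>(a, b). Complex (of_int a) (of_int b)) ` (R \<times> (R \<union> uminus ` R)))"
  have V: "finite V" using assms(1) by (simp add: V_def)
  define m where "m = (\<Sum>v\<in>V. norm v)"
  have m: "norm v \<le> m" if "v \<in> V" for v
    unfolding m_def using V that by (intro member_le_sum) auto
  have m0: "0 \<le> m" by (simp add: m_def sum_nonneg)
  \<comment> \<open>The trivial bound for one Fourier coefficient of \<open>h\<close>:
    \<open>D + 1\<close> terms of modulus at most \<open>2 ^ D * m\<close>, times
    \<open>2 * pi\<close>.\<close>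
  define C0 where "C0 = 2 * pi * (real (D + 1) * (2 ^ D * m))"
  \<comment> \<open>The bound and the lower threshold become functions of the upper threshold
    \<open>c\<close>, so that scales can be iterated.\<close>
  obtain NN ee where gap: "\<And>c h. 0 < c \<Longrightarrow> continuous_on {0..2*pi} h \<Longrightarrow>
     integral {0..2*pi} (\<lambda>\<theta>. norm (h \<theta>)) \<le> C0 \<Longrightarrow>
     (\<And>r. c \<le> norm (fourier_coeff h r) \<or> norm (fourier_coeff h r) \<le> ee c) \<Longrightarrow>
     finite {r. c \<le> norm (fourier_coeff h r)} \<Longrightarrow> card {r. c \<le> norm (fourier_coeff h r)} \<le> NN c"
    and ee: "\<And>c::real. 0 < c \<Longrightarrow> 0 < ee c"
  proof -
    have "\<forall>c. \<exists>N \<epsilon>. 0 < c \<longrightarrow> (0 < \<epsilon> \<and> (\<forall>h. continuous_on {0..2*pi} h \<longrightarrow>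
     integral {0..2*pi} (\<lambda>\<theta>. norm (h \<theta>)) \<le> C0 \<longrightarrow>
     (\<forall>r. c \<le> norm (fourier_coeff h r) \<or> norm (fourier_coeff h r) \<le> \<epsilon>) \<longrightarrow>
     finite {r. c \<le> norm (fourier_coeff h r)} \<longrightarrow> card {r. c \<le> norm (fourier_coeff h r)} \<le> N))"
      using large_spectrum_bounded[of _ C0] by blast
    then obtain NN ee where *: "\<forall>c. 0 < c \<longrightarrow> (0 < ee c \<and> (\<forall>h. continuous_on {0..2*pi} h \<longrightarrow>
     integral {0..2*pi} (\<lambda>\<theta>. norm (h \<theta>)) \<le> C0 \<longrightarrow>
     (\<forall>r. c \<le> norm (fourier_coeff h r) \<or> norm (fourier_coeff h r) \<le> ee c) \<longrightarrow>
     finite {r. c \<le> norm (fourier_coeff h r)} \<longrightarrow> card {r. c \<le> norm (fourier_coeff h r)} \<le> NN c))"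
      unfolding choice_iff by (elim exE)
    show thesis by (rule that[of ee NN]) (use * in blast)+
  qed
  \<comment> \<open>The start \<open>\<pi> / 2\<close> makes the recurrence error at most \<open>1/4\<close>, so two values of \<open>c\<close> with the same
    predecessors differ by less than 1, the least distance between Gaussian integers.\<close>
  define \<kappa> where "\<kappa> = rec_nat (pi / 2) (\<lambda>_ x. min (ee x) (x / 2))"
  have \<kappa>_0: "\<kappa> 0 = pi / 2" and \<kappa>_Suc: "\<kappa> (Suc i) = min (ee (\<kappa> i)) (\<kappa> i / 2)" for i
    by (simp_all add: \<kappa>_def)
  have \<kappa>_pos: "0 < \<kappa> i" for i
    by (induction i) (auto simp: \<kappa>_0 \<kappa>_Suc ee)
  \<comment> \<open>The cap \<open>x / 2\<close> forces the scales to decrease whatever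
    \<open>ee\<close> is.\<close>
  have \<kappa>_dec: "decseq \<kappa>"
    by (rule decseq_SucI) (use \<kappa>_pos less_imp_le in \<open>auto simp: \<kappa>_Suc min_le_iff_disj\<close>)
  \<comment> \<open>The number of possible windows of length \<open>D + 1\<close>, hence a bound for
    the number of moduli of Fourier coefficients of a given \<open>h\<close>.\<close>
  define M where "M = card (PiE {..D} (\<lambda>_. V))"
  define Nmax where "Nmax = (\<Sum>i\<le>M. NN (\<kappa> i))"
  define N where "N = card (PiE {1..D} (\<lambda>_. V)) + 1"
  \<comment> \<open>One more than the number of intervals, as \<open>L < C\<close> is strict; it
    also exceeds the periods, which are at most \<open>N\<close>.\<close>
  define C where "C = N + 1 + Nmax * (N + 2) + 1"
  have main: "periodic_split A B C 1 (int n) (N + 1 + Nmax * (N + 2))"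
    if R: "\<And>r. r \<in> {1..int n} \<Longrightarrow> A r \<in> R \<and> B r \<in> R"
      and roots: "at_most_roots K (trig_poly A B n) {0..2 * pi}" for n A B
  proof -
    define c where "c = trig_coeff A B n"
    have cV: "c r \<in> V" for r
    proof -
      have "Complex (of_int a) (of_int b) \<in> V" if "a \<in> R" "b \<in> R \<union> uminus ` R" for a b
        using that unfolding V_def by force
      from this[of "A r" "- B r"] this[of "A (- r)" "B (- r)"] show ?thesis
        using R[of r] R[of "- r"] by (auto simp: c_def trig_coeff_def V_def)
    qed
    define X where "X = {1..int n} \<union> uminus ` {1..int n}"
    have X: "finite X" "\<And>s. s \<notin> X \<Longrightarrow> c s = 0"
      by (force simp: X_def c_def trig_coeff_def)+
    define f where "f \<theta> = 2 * trig_poly A B n \<theta>" for \<theta>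
    have f: "continuous_on {0..2*pi} f" unfolding f_def trig_poly_def by (intro continuous_intros)
    have "at_most_roots K f {0..2*pi}" using roots by (simp add: f_def at_most_roots_def)
    from exists_sine_multiplier[OF f this] obtain ts s where ts: "length ts = 2 * K" "s \<in> {-1, 1}"
      "\<And>\<theta>. \<theta> \<in> {0..2*pi} \<Longrightarrow> 0 \<le> s * f \<theta> * (\<Prod>t\<leftarrow>ts. 2 * sin ((\<theta> - t) / 2))" by blast
    define P where "P = unit_poly ts"
    have degP: "degree P \<le> D" using degree_unit_poly[of ts] ts(1) by (simp add: P_def D_def)
    define h where "h \<theta> = complex_of_real (f \<theta>) * poly P (cis \<theta>)" for \<theta>
    have h: "continuous_on {0..2*pi} h" unfolding h_def by (intro continuous_intros f)
    define w where "w x = (\<Sum>j\<le>D. coeff P j * x j)" for x :: "nat \<Rightarrow> complex"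
    have fourier_coeff: "fourier_coeff h r = 2 * of_real pi * w (\<lambda>j. c (r - int j))" for r
      unfolding h_def[abs_def] f_def trig_poly_exponential w_def X_def[symmetric] c_def[symmetric]
      by (rule fourier_coeff_convolution[OF X degP])
    have norm_fourier_coeff: "norm (fourier_coeff h r) = 2 * pi * norm (w (\<lambda>j. c (r - int j)))" for r
      by (simp add: fourier_coeff norm_mult)
    have "norm (w (\<lambda>j. c (r - int j))) \<le> (\<Sum>j\<le>D. 2 ^ D * m)" for r
      unfolding w_def
    proof (rule sum_norm_le)
      fix j
      show "norm (coeff P j * c (r - int j)) \<le> 2 ^ D * m"
        unfolding norm_mult using norm_coeff_unit_poly[of ts j] ts(1) m[OF cV] m0
        by (intro mult_mono) (auto simp: P_def D_def)
    qed
    then have "norm (fourier_coeff h r) \<le> C0" for r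
      unfolding norm_fourier_coeff C0_def by (intro mult_left_mono) auto
    then have L1: "integral {0..2*pi} (\<lambda>\<theta>. norm (h \<theta>)) \<le> C0"
      by (subst integral_norm_multiplier[OF ts(1,2) f ts(3)]) (auto simp: h_def P_def)
    define vals where "vals = (\<lambda>x. 2 * pi * norm (w x)) ` PiE {..D} (\<lambda>_. V)"
    have vals: "norm (fourier_coeff h r) \<in> vals" for r
    proof -
      have "w (\<lambda>j. c (r - int j)) = w (restrict (\<lambda>j. c (r - int j)) {..D})"
        by (simp add: w_def)
      moreover have "restrict (\<lambda>j. c (r - int j)) {..D} \<in> PiE {..D} (\<lambda>_. V)" using cV by auto
      ultimately show ?thesis unfolding vals_def norm_fourier_coeff by auto
    qed
    have finvals: "finite vals" "card vals \<le> M"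
      unfolding vals_def M_def using V by (auto intro!: finite_PiE card_image_le)
    \<comment> \<open>The \<open>M + 1\<close> open gaps between consecutive scales are disjoint, so
      the at most \<open>M\<close> values miss one of them.\<close>
    have "\<exists>i\<le>M. \<forall>v\<in>vals. \<not> (\<kappa> (Suc i) < v \<and> v < \<kappa> i)"
    proof (rule ccontr)
      assume "\<not> ?thesis"
      then obtain v where v: "\<And>i. i \<le> M \<Longrightarrow> v i \<in> vals \<and> \<kappa> (Suc i) < v i \<and> v i < \<kappa> i" by metis
      have "v j < v i" if "i < j" "j \<le> M" for i j
        using v[of i] v[of j] decseqD[OF \<kappa>_dec, of "Suc i" j] that by simp
      then have "inj_on v {..M}"
        by (intro inj_onI) (metis atMost_iff less_irrefl linorder_neqE_nat)
      moreover have "v ` {..M} \<subseteq> vals" using v by blast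
      ultimately have "card {..M} \<le> card vals" using finvals(1) by (rule card_inj_on_le)
      then show False using finvals by simp
    qed
    then obtain i where i: "i \<le> M" "\<And>v. v \<in> vals \<Longrightarrow> \<kappa> i \<le> v \<or> v \<le> \<kappa> (Suc i)"
      by (meson not_less)
    define \<Lambda> where "\<Lambda> = {r. \<kappa> i \<le> norm (fourier_coeff h r)}"
    have fin: "finite \<Lambda>"
    proof (rule finite_subset)
      show "\<Lambda> \<subseteq> (\<Union>j\<le>D. (\<lambda>s. s + int j) ` X)"
      proof
        fix r assume "r \<in> \<Lambda>"
        then have "fourier_coeff h r \<noteq> 0" using \<kappa>_pos[of i] by (auto simp: \<Lambda>_def)
        then obtain j where "j \<le> D" "c (r - int j) \<noteq> 0"
          unfolding fourier_coeff w_def by (metis (mono_tags, lifting) atMost_iff mult_zero_right sum.neutral)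
        then have "r - int j \<in> X" using X(2) by blast
        then show "r \<in> (\<Union>j\<le>D. (\<lambda>s. s + int j) ` X)" using \<open>j \<le> D\<close> by force
      qed
    qed (use X in auto)
    have "card \<Lambda> \<le> NN (\<kappa> i)"
      unfolding \<Lambda>_def
    proof (rule gap[OF \<kappa>_pos h L1])
      show "\<kappa> i \<le> norm (fourier_coeff h r) \<or> norm (fourier_coeff h r) \<le> ee (\<kappa> i)" for r
        using i(2)[OF vals[of r]] by (auto simp: \<kappa>_Suc)
    qed (use fin in \<open>simp add: \<Lambda>_def\<close>)
    also have "\<dots> \<le> Nmax" unfolding Nmax_def using i(1) by (intro member_le_sum) auto
    finally have card\<Lambda>: "card (\<Lambda> \<inter> {1..int n}) \<le> Nmax"
      using card_mono[OF fin, of "\<Lambda> \<inter> {1..int n}"] by simp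
    have small: "norm (w (\<lambda>j. c (r - int j))) < 1 / 4" if "r \<notin> \<Lambda>" for r
    proof -
      have "2 * pi * norm (w (\<lambda>j. c (r - int j))) < \<kappa> i" using that by (simp add: \<Lambda>_def norm_fourier_coeff)
      also have "\<dots> \<le> 2 * pi * (1 / 4)" using decseqD[OF \<kappa>_dec, of 0 i] by (simp add: \<kappa>_0)
      finally show ?thesis by (subst (asm) mult_less_cancel_left_pos) auto
    qed
    show ?thesis
    proof (rule periodic_split_exceptional[where c = c and D = D, OF V cV _ _ _ _ _ card\<Lambda>])
      show "c x = c y" if xy: "x \<in> {1..int n} - \<Lambda>" "y \<in> {1..int n} - \<Lambda>"
        and prev: "\<And>j. j \<in> {1..D} \<Longrightarrow> c (x - int j) = c (y - int j)" for x y
      proof -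
        have "w (\<lambda>j. c (x - int j)) - w (\<lambda>j. c (y - int j)) = (\<Sum>j\<le>D. coeff P j * (c (x - int j) - c (y - int j)))"
          by (simp add: w_def sum_subtractf right_diff_distrib)
        \<comment> \<open>Equal predecessors cancel all terms except the newest, whose coefficient
          is unimodular.\<close>
        also have "\<dots> = (\<Sum>j\<in>{0}. coeff P j * (c (x - int j) - c (y - int j)))"
          using prev by (intro sum.mono_neutral_right) auto
        finally have "norm (c x - c y) = norm (w (\<lambda>j. c (x - int j)) - w (\<lambda>j. c (y - int j)))"
          using norm_coeff_0_unit_poly[of ts] by (simp add: norm_mult P_def)
        also have "\<dots> \<le> norm (w (\<lambda>j. c (x - int j))) + norm (w (\<lambda>j. c (y - int j)))"
          by (rule norm_triangle_ineq4)
        also have "\<dots> < 1" using small[of x] small[of y] xy by simp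
        finally have "norm (c x - c y) < 1" .
        then have "\<bar>Re (c x - c y)\<bar> < 1" "\<bar>Im (c x - c y)\<bar> < 1"
          using abs_Re_le_cmod abs_Im_le_cmod order_le_less_trans by blast+
        then have "\<bar>real_of_int (A x - A y)\<bar> < 1" "\<bar>real_of_int (B y - B x)\<bar> < 1"
          using xy by (simp_all add: c_def trig_coeff_def)
        then have "A x = A y" "B x = B y" by linarith+
        then show "c x = c y" using xy by (simp add: c_def trig_coeff_def)
      qed
      show "A x = A y \<and> B x = B y" if "x \<in> {1..int n}" "y \<in> {1..int n}" "c x = c y" for x y
        using that by (simp add: c_def trig_coeff_def)
    qed (auto simp: N_def C_def)
  qed
  show ?thesis
  proof (rule exI[of _ C], intro conjI allI impI)
    fix n A B
    assume "\<forall>r\<in>{1..int n}. A r \<in> R \<and> B r \<in> R" "at_most_roots K (trig_poly A B n) {0..2 * pi}"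
    then have "periodic_split A B C 1 (int n) (N + 1 + Nmax * (N + 2))" by (intro main) auto
    moreover have "N + 1 + Nmax * (N + 2) < C" by (simp add: C_def)
    ultimately show "\<exists>(L::nat) (I :: nat \<Rightarrow> int set). L < C \<and> (\<forall>i\<in>{1..L}. int_interval (I i)) \<and>
          disjoint_family_on I {1..L} \<and> (\<Union>i\<in>{1..L}. I i) = {1..int n} \<and>
          (\<forall>i\<in>{1..L}. (\<exists>p\<le>C. periodic_on (I i) A p) \<and> (\<exists>q\<le>C. periodic_on (I i) B q))"
      unfolding periodic_split_def by blast
  qed (simp add: C_def)
qed

end
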